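(* Let $X,Y$ be complex Banach spaces, $A_0,A_1\in\mathcal B(X,Y)$ nonzero, with pencil $A(z)=A_0+zA_1$ satisfying the standing assumptions in the context, with spectral set $\sigma$ and spectral projections $P_\zeta\in\mathcal B(X)$, $Q_\zeta\in\mathcal B(Y)$ for $\zeta\in\sigma$. For each $\zeta\in\sigma$ the spaces $X_\zeta=P_\zeta X$ and $Y_\zeta=Q_\zeta Y$ are closed Banach subspaces, and $X=\bigoplus_{\zeta\in\sigma}X_\zeta$ and $Y=\bigoplus_{\zeta\in\sigma}Y_\zeta$ as finite internal topological direct sums. Equivalently, the finite coordinate maps $\Phi_X:X\to\prod_{\zeta\in\sigma}X_\zeta$ and $\Phi_Y:Y\to\prod_{\zeta\in\sigma}Y_\zeta$ defined by $x\mapsto(x_\zeta)_{\zeta\in\sigma}$ and $y\mapsto(y_\zeta)_{\zeta\in\sigma}$, where $x_\zeta=P_\zeta x$ and $y_\zeta=Q_\zeta y$, with product space norms $\|(x_\zeta)_{\zeta\in\sigma}\|=\max_{\zeta\in\sigma}\|x_\zeta\|$ and $\|(y_\zeta)_{\zeta\in\sigma}\|=\max_{\zeta\in\sigma}\|y_\zeta\|$, are Banach space isomorphisms with inverse mappings defined by $(x_\zeta)_{\zeta\in\sigma}\mapsto\sum_{\zeta\in\sigma}x_\zeta$ and $(y_\zeta)_{\zeta\in\sigma}\mapsto\sum_{\zeta\in\sigma}y_\zeta$.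
   Context: Spectral set: $\sigma\subset\mathbb C_\infty=\mathbb C\cup\{\infty\}$ consists of those $\zeta\in\mathbb C$ for which $A(\zeta)$ has no bounded inverse in $\mathcal B(Y,X)$, together with $\infty$ if $A_1$ has no bounded inverse in $\mathcal B(Y,X)$. Standing assumptions: $\sigma\ne\emptyset$ consists of finitely many isolated points; the resolvent $R(z)=A(z)^{-1}\in\mathcal B(Y,X)$ is analytic on $\mathbb C_\infty\setminus\sigma$; $R$ has a Laurent series in a deleted neighbourhood of each spectral point (poles and isolated essential singularities are both allowed). Laurent coefficients: for $\zeta\in\sigma\cap\mathbb C$ write $R(z)=\sum_{j\in\mathbb Z}(z-\zeta)^jR_{\zeta,j}$, $R_{\zeta,j}\in\mathcal B(Y,X)$, for $0<|z-\zeta|<r$ with $r$ small enough. If $\infty\in\sigma$, write $R(z)=\sum_{j\in\mathbb Z}z^jR_{\infty,j}$ for $|z|>r$, where $r>0$ is such that $|\zeta|<r$ for all $\zeta\in\sigma\cap\mathbb C$. Spectral projections: $P_\zeta=R_{\zeta,-1}A_1\in\mathcal B(X)$ and $Q_\zeta=A_1R_{\zeta,-1}\in\mathcal B(Y)$ for $\zeta\in\sigma\cap\mathbb C$; $P_\infty=R_{\infty,0}A_0\in\mathcal B(X)$ and $Q_\infty=A_0R_{\infty,0}\in\mathcal B(Y)$ if $\infty\in\sigma$. *)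

theory Defs
  imports "HOL-Analysis.Analysis"
begin

text \<open>
  The analysis library only provides real normed and Banach spaces as type classes; complex
  scalars are added on top of them. The unit law follows from the one for \<^term>\<open>scaleR\<close>.
\<close>

class complex_normed_vector = real_normed_vector +
  fixes scaleC :: "complex \<Rightarrow> 'a \<Rightarrow> 'a"  (infixr "*\<^sub>C" 75)
  assumes scaleC_add_right: "c *\<^sub>C (x + y) = c *\<^sub>C x + c *\<^sub>C y"
    and scaleC_add_left: "(c + d) *\<^sub>C x = c *\<^sub>C x + d *\<^sub>C x"
    and scaleC_scaleC: "c *\<^sub>C (d *\<^sub>C x) = (c * d) *\<^sub>C x"
    and scaleR_scaleC: "r *\<^sub>R x = complex_of_real r *\<^sub>C x"
    and norm_scaleC: "norm (c *\<^sub>C x) = cmod c * norm x"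

class complex_banach = complex_normed_vector + banach

instantiation complex :: complex_banach
begin

definition scaleC_complex :: "complex \<Rightarrow> complex \<Rightarrow> complex" where
  "scaleC_complex c x = c * x"

instance
  by standard (simp_all add: scaleC_complex_def algebra_simps norm_mult scaleR_conv_of_real)

end

lemma bounded_linear_scaleC_right: "bounded_linear (\<lambda>x::'a::complex_normed_vector. c *\<^sub>C x)"
proof (rule bounded_linear_intro[where K = "cmod c"])
  fix r :: real and x y :: 'a
  show "c *\<^sub>C (x + y) = c *\<^sub>C x + c *\<^sub>C y"
    by (rule scaleC_add_right)
  show "c *\<^sub>C (r *\<^sub>R x) = r *\<^sub>R (c *\<^sub>C x)"
    by (simp add: scaleR_scaleC scaleC_scaleC mult.commute)
  show "norm (c *\<^sub>C x) \<le> norm x * cmod c"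
    by (simp add: norm_scaleC)
qed

text \<open>
  Real-linear bounded operators into a complex normed space form a complex normed space, the
  scalars acting on the values; the complex-linear ones among them are the set \<open>cblinfuns\<close> below.
\<close>

instantiation blinfun :: (real_normed_vector, complex_normed_vector) complex_normed_vector
begin

lift_definition scaleC_blinfun :: "complex \<Rightarrow> ('a \<Rightarrow>\<^sub>L 'b) \<Rightarrow> ('a \<Rightarrow>\<^sub>L 'b)"
  is "\<lambda>c f x. c *\<^sub>C f x"
  by (rule bounded_linear_compose[OF bounded_linear_scaleC_right])

instance
proof
  fix c d :: complex and r :: real and f g :: "'a \<Rightarrow>\<^sub>L 'b"
  show "c *\<^sub>C (f + g) = c *\<^sub>C f + c *\<^sub>C g"
    by transfer (simp add: scaleC_add_right)
  show "(c + d) *\<^sub>C f = c *\<^sub>C f + d *\<^sub>C f"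
    by transfer (simp add: scaleC_add_left)
  show "c *\<^sub>C (d *\<^sub>C f) = (c * d) *\<^sub>C f"
    by transfer (simp add: scaleC_scaleC)
  show "r *\<^sub>R f = complex_of_real r *\<^sub>C f"
    by transfer (simp add: scaleR_scaleC)
  show "norm (c *\<^sub>C f) = cmod c * norm f"
  proof (rule antisym)
    have cc: "a *\<^sub>C (b *\<^sub>C h) = (a * b) *\<^sub>C h" for a b and h :: "'a \<Rightarrow>\<^sub>L 'b"
      by transfer (simp add: scaleC_scaleC)
    have le: "norm (a *\<^sub>C h) \<le> cmod a * norm h" for a and h :: "'a \<Rightarrow>\<^sub>L 'b"
    proof (rule norm_blinfun_bound)
      fix x
      have "cmod a * norm (blinfun_apply h x) \<le> cmod a * (norm h * norm x)"
        by (intro mult_left_mono norm_blinfun norm_ge_zero)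
      then show "norm (blinfun_apply (a *\<^sub>C h) x) \<le> cmod a * norm h * norm x"
        by (simp only: scaleC_blinfun.rep_eq norm_scaleC mult.assoc)
    qed simp
    show "norm (c *\<^sub>C f) \<le> cmod c * norm f"
      by (rule le)
    show "cmod c * norm f \<le> norm (c *\<^sub>C f)"
    proof (cases "c = 0")
      case False
      have one: "1 *\<^sub>C f = f"
        by transfer (simp add: scaleR_scaleC[where r = 1, simplified, symmetric])
      have "f = inverse c *\<^sub>C (c *\<^sub>C f)"
        using False one by (simp only: cc left_inverse simp_thms)
      then have "norm f \<le> cmod (inverse c) * norm (c *\<^sub>C f)"
        using le[of "inverse c" "c *\<^sub>C f"] by simp
      then show ?thesis
        using False by (simp add: norm_inverse norm_divide field_simps)
    qed simp
  qed
qed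

end

definition cblinfuns :: "('a::complex_normed_vector \<Rightarrow>\<^sub>L 'b::complex_normed_vector) set" where
  "cblinfuns = {T. \<forall>c x. blinfun_apply T (c *\<^sub>C x) = c *\<^sub>C blinfun_apply T x}"

definition is_bounded_inverse ::
  "('a::complex_normed_vector \<Rightarrow>\<^sub>L 'b::complex_normed_vector) \<Rightarrow> ('b \<Rightarrow>\<^sub>L 'a) \<Rightarrow> bool" where
  "is_bounded_inverse T S \<longleftrightarrow>
     S \<in> cblinfuns \<and> S o\<^sub>L T = id_blinfun \<and> T o\<^sub>L S = id_blinfun"

definition has_bounded_inverse ::
  "('a::complex_normed_vector \<Rightarrow>\<^sub>L 'b::complex_normed_vector) \<Rightarrow> bool" where
  "has_bounded_inverse T \<longleftrightarrow> (\<exists>S. is_bounded_inverse T S)"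

definition csubspace :: "'a::complex_normed_vector set \<Rightarrow> bool" where
  "csubspace V \<longleftrightarrow>
     0 \<in> V \<and> (\<forall>x\<in>V. \<forall>y\<in>V. x + y \<in> V) \<and> (\<forall>c. \<forall>x\<in>V. c *\<^sub>C x \<in> V)"

datatype riemann_sphere = Cpx complex | Infty

definition pencil ::
  "('x::complex_normed_vector \<Rightarrow>\<^sub>L 'y::complex_normed_vector) \<Rightarrow> ('x \<Rightarrow>\<^sub>L 'y) \<Rightarrow> complex \<Rightarrow> ('x \<Rightarrow>\<^sub>L 'y)"
  where "pencil A0 A1 z = A0 + z *\<^sub>C A1"

definition pencil_spectrum ::
  "('x::complex_normed_vector \<Rightarrow>\<^sub>L 'y::complex_normed_vector) \<Rightarrow> ('x \<Rightarrow>\<^sub>L 'y) \<Rightarrow> riemann_sphere set"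
  where "pencil_spectrum A0 A1 =
     {Cpx \<zeta> | \<zeta>. \<not> has_bounded_inverse (pencil A0 A1 \<zeta>)} \<union>
     {p. p = Infty \<and> \<not> has_bounded_inverse A1}"

text \<open>Only meaningful off the spectrum, where the inverse exists and is unique.\<close>

definition resolvent ::
  "('x::complex_normed_vector \<Rightarrow>\<^sub>L 'y::complex_normed_vector) \<Rightarrow> ('x \<Rightarrow>\<^sub>L 'y) \<Rightarrow> complex \<Rightarrow> ('y \<Rightarrow>\<^sub>L 'x)"
  where "resolvent A0 A1 z = (THE S. is_bounded_inverse (pencil A0 A1 z) S)"

text \<open>
  Vector-valued analogues of \<^term>\<open>(holomorphic_on)\<close> and \<^term>\<open>(analytic_on)\<close>, which are
  confined to functions between complex numbers. Analyticity at infinity is analyticity at 0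
  of \<open>w \<mapsto> f (1 / w)\<close>, after the removable point 0 has been filled in by \<open>g\<close>.
\<close>

definition cdifferentiable_at :: "(complex \<Rightarrow> 'a::complex_normed_vector) \<Rightarrow> complex \<Rightarrow> bool" where
  "cdifferentiable_at f z \<longleftrightarrow> (\<exists>D. (f has_derivative (\<lambda>h. h *\<^sub>C D)) (at z))"

fun analytic_at_point :: "(complex \<Rightarrow> 'a::complex_normed_vector) \<Rightarrow> riemann_sphere \<Rightarrow> bool" where
  "analytic_at_point f (Cpx z) \<longleftrightarrow> (\<exists>e>0. \<forall>w\<in>ball z e. cdifferentiable_at f w)"
| "analytic_at_point f Infty \<longleftrightarrow>
     (\<exists>e>0. \<exists>g. (\<forall>w\<in>ball 0 e. cdifferentiable_at g w) \<and> (\<forall>w\<in>ball 0 e - {0}. g w = f (1 / w)))"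

text \<open>
  Unconditional summability over the integers is no restriction, since a Laurent series that
  represents a function on an open annulus converges absolutely there. In the second clause
  the annulus at infinity must avoid the finite part of the singular set \<open>S\<close>.
\<close>

fun laurent_coeffs ::
  "riemann_sphere set \<Rightarrow> (complex \<Rightarrow> 'a::complex_normed_vector) \<Rightarrow> riemann_sphere \<Rightarrow> (int \<Rightarrow> 'a) \<Rightarrow> bool"
where
  "laurent_coeffs S f (Cpx \<zeta>) c \<longleftrightarrow>
     (\<exists>r>0. \<forall>z. 0 < cmod (z - \<zeta>) \<and> cmod (z - \<zeta>) < r \<longrightarrow>
        ((\<lambda>j. ((z - \<zeta>) powi j) *\<^sub>C c j) has_sum f z) UNIV)"
| "laurent_coeffs S f Infty c \<longleftrightarrow>
     (\<exists>r>0. (\<forall>\<zeta>. Cpx \<zeta> \<in> S \<longrightarrow> cmod \<zeta> < r) \<and>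
        (\<forall>z. cmod z > r \<longrightarrow> ((\<lambda>j. (z powi j) *\<^sub>C c j) has_sum f z) UNIV))"

text \<open>In the following, \<open>L \<zeta> j\<close> is the \<open>j\<close>-th Laurent coefficient of the resolvent at \<open>\<zeta>\<close>.\<close>

fun spectral_proj_dom ::
  "('x::complex_normed_vector \<Rightarrow>\<^sub>L 'y::complex_normed_vector) \<Rightarrow> ('x \<Rightarrow>\<^sub>L 'y) \<Rightarrow>
   (riemann_sphere \<Rightarrow> int \<Rightarrow> ('y \<Rightarrow>\<^sub>L 'x)) \<Rightarrow> riemann_sphere \<Rightarrow> ('x \<Rightarrow>\<^sub>L 'x)"
where
  "spectral_proj_dom A0 A1 L (Cpx \<zeta>) = L (Cpx \<zeta>) (-1) o\<^sub>L A1"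
| "spectral_proj_dom A0 A1 L Infty = L Infty 0 o\<^sub>L A0"

fun spectral_proj_cod ::
  "('x::complex_normed_vector \<Rightarrow>\<^sub>L 'y::complex_normed_vector) \<Rightarrow> ('x \<Rightarrow>\<^sub>L 'y) \<Rightarrow>
   (riemann_sphere \<Rightarrow> int \<Rightarrow> ('y \<Rightarrow>\<^sub>L 'x)) \<Rightarrow> riemann_sphere \<Rightarrow> ('y \<Rightarrow>\<^sub>L 'y)"
where
  "spectral_proj_cod A0 A1 L (Cpx \<zeta>) = A1 o\<^sub>L L (Cpx \<zeta>) (-1)"
| "spectral_proj_cod A0 A1 L Infty = A0 o\<^sub>L L Infty 0"

definition topological_direct_sum ::
  "'i set \<Rightarrow> ('i \<Rightarrow> 'a::complex_normed_vector set) \<Rightarrow> bool" where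
  "topological_direct_sum I V \<longleftrightarrow>
     finite I \<and> (\<forall>i\<in>I. csubspace (V i)) \<and>
     (\<forall>x. \<exists>!f. f \<in> (\<Pi>\<^sub>E i\<in>I. V i) \<and> x = (\<Sum>i\<in>I. f i)) \<and>
     homeomorphic_map (product_topology (\<lambda>i. top_of_set (V i)) I) euclidean (\<lambda>f. \<Sum>i\<in>I. f i)"

text \<open>
  The product of the subspaces \<open>V i\<close> is the set of extensional functions
  \<^term>\<open>\<Pi>\<^sub>E i\<in>I. V i\<close> with pointwise operations on \<open>I\<close> and the norm \<open>max_norm I\<close>, for finite
  nonempty \<open>I\<close>.
\<close>

definition max_norm :: "'i set \<Rightarrow> ('i \<Rightarrow> 'a::real_normed_vector) \<Rightarrow> real" where
  "max_norm I f = (MAX i\<in>I. norm (f i))"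

definition banach_product :: "'i set \<Rightarrow> ('i \<Rightarrow> 'a::complex_normed_vector set) \<Rightarrow> bool" where
  "banach_product I V \<longleftrightarrow>
     finite I \<and> I \<noteq> {} \<and> (\<forall>i\<in>I. csubspace (V i)) \<and>
     Metric_space (\<Pi>\<^sub>E i\<in>I. V i) (\<lambda>f g. max_norm I (\<lambda>i. f i - g i)) \<and>
     Metric_space.mcomplete (\<Pi>\<^sub>E i\<in>I. V i) (\<lambda>f g. max_norm I (\<lambda>i. f i - g i))"

definition banach_product_isomorphism ::
  "'i set \<Rightarrow> ('i \<Rightarrow> 'a::complex_banach set) \<Rightarrow> ('a \<Rightarrow> 'i \<Rightarrow> 'a) \<Rightarrow> (('i \<Rightarrow> 'a) \<Rightarrow> 'a) \<Rightarrow> bool" where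
  "banach_product_isomorphism I V \<Phi> \<Psi> \<longleftrightarrow>
     banach_product I V \<and>
     bij_betw \<Phi> UNIV (\<Pi>\<^sub>E i\<in>I. V i) \<and>
     (\<forall>x. \<Psi> (\<Phi> x) = x) \<and> (\<forall>f\<in>(\<Pi>\<^sub>E i\<in>I. V i). \<Phi> (\<Psi> f) = f) \<and>
     (\<forall>x y. \<Phi> (x + y) = (\<lambda>i\<in>I. \<Phi> x i + \<Phi> y i)) \<and>
     (\<forall>c x. \<Phi> (c *\<^sub>C x) = (\<lambda>i\<in>I. c *\<^sub>C \<Phi> x i)) \<and>
     (\<exists>C. \<forall>x. max_norm I (\<Phi> x) \<le> C * norm x) \<and>
     (\<exists>C. \<forall>f\<in>(\<Pi>\<^sub>E i\<in>I. V i). norm (\<Psi> f) \<le> C * max_norm I f)"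

end

theory Submission
  imports Defs
begin

text \<open>
  Write \<open>R\<^sub>\<zeta> = L (Cpx \<zeta>) (-1)\<close>. Comparing Laurent coefficients in \<open>R(z) A(z) = 1\<close> and
  \<open>A(z) R(z) = 1\<close> gives recursions which, together with the decay of the coefficients, yield
  \<open>R\<^sub>\<zeta> A1 R\<^sub>\<zeta> = R\<^sub>\<zeta>\<close> and \<open>R\<^sub>\<zeta> A1 R\<^sub>\<eta> = 0\<close> for \<open>\<zeta> \<noteq> \<eta>\<close>. Hence the finite projections are orthogonal
  idempotents, and their sums \<open>P0\<close>, \<open>Q0\<close> intertwine the pencil. On the complements of their
  ranges the pencil is invertible for every complex \<open>z\<close>. Its inverse \<open>G\<close> satisfies the resolvent
  identity everywhere, so it is continuously differentiable and its integral over any circle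
  around \<open>0\<close> vanishes. If \<open>\<infinity>\<close> is not in the spectrum, \<open>z G(z)\<close> tends to \<open>A1\<^sup>-\<^sup>1 (1 - Q0)\<close> and
  therefore \<open>Q0 = 1\<close>. Otherwise the Laurent coefficient at \<open>\<infinity>\<close> of index \<open>-1\<close> is the sum of the
  \<open>R\<^sub>\<zeta>\<close>, so the projections at \<open>\<infinity>\<close> are \<open>1 - P0\<close> and \<open>1 - Q0\<close>.
\<close>

section \<open>Finite resolutions of the identity\<close>

lemma csubspace_range:
  assumes "T \<in> cblinfuns"
  shows "csubspace (range (blinfun_apply T))"
  unfolding csubspace_def
proof (intro conjI ballI allI)
  show "0 \<in> range (blinfun_apply T)"
    using rangeI[of "blinfun_apply T" 0] by (simp add: blinfun.zero_right)
next
  fix x y assume "x \<in> range (blinfun_apply T)" "y \<in> range (blinfun_apply T)"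
  then obtain a b where "x = T a" "y = T b" by blast
  then show "x + y \<in> range (blinfun_apply T)"
    using rangeI[of "blinfun_apply T" "a + b"] by (simp add: blinfun.add_right)
next
  fix c x assume "x \<in> range (blinfun_apply T)"
  then obtain a where "x = T a" by blast
  then have "c *\<^sub>C x = T (c *\<^sub>C a)"
    using assms by (simp add: cblinfuns_def)
  then show "c *\<^sub>C x \<in> range (blinfun_apply T)"
    by simp
qed

text \<open>An idempotent has its range as fixed-point set, and a fixed-point set of a continuous
  map is closed.\<close>

lemma closed_range_idempotent:
  fixes T :: "'a::real_normed_vector \<Rightarrow>\<^sub>L 'a"
  assumes "T o\<^sub>L T = T"
  shows "closed (range (blinfun_apply T))"
proof -
  have "T (T x) = T x" for x
    using arg_cong[OF assms, of "\<lambda>S. blinfun_apply S x"] by simp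
  then have "range (blinfun_apply T) = {x. T x = x}"
    by (auto simp: image_iff) (metis)
  moreover have "closed {x. blinfun_apply T x = x}"
    by (intro closed_Collect_eq continuous_intros)
  ultimately show ?thesis
    by simp
qed

section \<open>Finite products of closed subspaces under the maximum norm\<close>

lemma max_norm_ge: "finite I \<Longrightarrow> i \<in> I \<Longrightarrow> norm (f i) \<le> max_norm I f"
  unfolding max_norm_def by (intro Max_ge) auto

lemma max_norm_le_iff:
  "finite I \<Longrightarrow> I \<noteq> {} \<Longrightarrow> max_norm I f \<le> C \<longleftrightarrow> (\<forall>i\<in>I. norm (f i) \<le> C)"
  unfolding max_norm_def by (subst Max_le_iff) auto

lemma max_norm_less_iff:
  "finite I \<Longrightarrow> I \<noteq> {} \<Longrightarrow> max_norm I f < C \<longleftrightarrow> (\<forall>i\<in>I. norm (f i) < C)"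
  unfolding max_norm_def by (subst Max_less_iff) auto

lemma Metric_space_max_norm:
  fixes V :: "'i \<Rightarrow> 'a::real_normed_vector set"
  assumes "finite I" "I \<noteq> {}"
  shows "Metric_space (\<Pi>\<^sub>E i\<in>I. V i) (\<lambda>f g. max_norm I (\<lambda>i. f i - g i))"
proof
  fix f g h :: "'i \<Rightarrow> 'a"
  obtain i0 where i0: "i0 \<in> I" using assms by blast
  show "0 \<le> max_norm I (\<lambda>i. f i - g i)"
    using max_norm_ge[OF assms(1) i0, of "\<lambda>i. f i - g i"] norm_ge_zero order_trans by blast
  show "max_norm I (\<lambda>i. f i - g i) = max_norm I (\<lambda>i. g i - f i)"
    unfolding max_norm_def by (simp add: norm_minus_commute)
  show "(max_norm I (\<lambda>i. f i - g i) = 0) = (f = g)"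
    if "f \<in> (\<Pi>\<^sub>E i\<in>I. V i)" "g \<in> (\<Pi>\<^sub>E i\<in>I. V i)"
  proof
    assume "max_norm I (\<lambda>i. f i - g i) = 0"
    then have "\<forall>i\<in>I. norm (f i - g i) \<le> 0"
      using max_norm_le_iff[OF assms, of "\<lambda>i. f i - g i" 0] by simp
    then show "f = g"
      using that by (intro PiE_ext) auto
  next
    assume "f = g"
    then show "max_norm I (\<lambda>i. f i - g i) = 0"
      using assms unfolding max_norm_def by simp
  qed
  show "max_norm I (\<lambda>i. f i - h i) \<le> max_norm I (\<lambda>i. f i - g i) + max_norm I (\<lambda>i. g i - h i)"
    unfolding max_norm_le_iff[OF assms]
  proof
    fix i assume i: "i \<in> I"
    have "norm (f i - h i) \<le> norm (f i - g i) + norm (g i - h i)"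
      using norm_triangle_ineq[of "f i - g i" "g i - h i"] by simp
    then show "norm (f i - h i) \<le> max_norm I (\<lambda>i. f i - g i) + max_norm I (\<lambda>i. g i - h i)"
      using max_norm_ge[OF assms(1) i, of "\<lambda>i. f i - g i"]
        max_norm_ge[OF assms(1) i, of "\<lambda>i. g i - h i"] by linarith
  qed
qed

text \<open>A Cauchy sequence in the maximum norm is Cauchy in each coordinate. The coordinate
  limits stay in the closed sets \<open>V i\<close>, and finiteness of \<open>I\<close> makes the
  convergence simultaneous in all coordinates.\<close>

lemma banach_product_closed:
  fixes V :: "'i \<Rightarrow> 'a::complex_banach set"
  assumes "finite I" "I \<noteq> {}" "\<And>i. i \<in> I \<Longrightarrow> csubspace (V i)" "\<And>i. i \<in> I \<Longrightarrow> closed (V i)"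
  shows "banach_product I V"
proof -
  interpret Metric_space "\<Pi>\<^sub>E i\<in>I. V i" "\<lambda>f g. max_norm I (\<lambda>i. f i - g i)"
    using Metric_space_max_norm[OF assms(1,2)] .
  have mcomplete
    unfolding mcomplete_def
  proof (intro allI impI)
    fix s assume s: "MCauchy s"
    have mem: "s n \<in> (\<Pi>\<^sub>E i\<in>I. V i)" for n
      using s unfolding MCauchy_def by blast
    have "\<exists>l. l \<in> V i \<and> (\<lambda>n. s n i) \<longlonglongrightarrow> l" if i: "i \<in> I" for i
    proof -
      have "Cauchy (\<lambda>n. s n i)"
        unfolding Cauchy_def dist_norm
      proof (intro allI impI)
        fix e :: real assume "e > 0"
        then obtain N where "\<forall>n n'. N \<le> n \<longrightarrow> N \<le> n' \<longrightarrow> max_norm I (\<lambda>i. s n i - s n' i) < e"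
          using s unfolding MCauchy_def by blast
        then show "\<exists>N. \<forall>m\<ge>N. \<forall>n\<ge>N. norm (s m i - s n i) < e"
          using i by (auto simp: max_norm_less_iff[OF assms(1,2)] intro!: exI[of _ N])
      qed
      then obtain l where l: "(\<lambda>n. s n i) \<longlonglongrightarrow> l"
        using Cauchy_convergent convergentD by blast
      moreover have "l \<in> V i"
        using assms(4)[OF i] mem i l by (metis PiE_mem closed_sequentially)
      ultimately show ?thesis by blast
    qed
    then obtain l where l: "\<And>i. i \<in> I \<Longrightarrow> l i \<in> V i" "\<And>i. i \<in> I \<Longrightarrow> (\<lambda>n. s n i) \<longlonglongrightarrow> l i"
      by metis
    have "limitin mtopology s (restrict l I) sequentially"
      unfolding limitin_metric max_norm_less_iff[OF assms(1,2)]
    proof (intro conjI allI impI)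
      show "restrict l I \<in> (\<Pi>\<^sub>E i\<in>I. V i)"
        using l by simp
      fix e :: real assume "e > 0"
      then have "\<forall>\<^sub>F n in sequentially. \<forall>i\<in>I. norm (s n i - l i) < e"
        using l(2) assms(1) by (intro eventually_ball_finite) (auto simp: tendsto_iff dist_norm)
      then show "\<forall>\<^sub>F n in sequentially. s n \<in> (\<Pi>\<^sub>E i\<in>I. V i) \<and>
          (\<forall>i\<in>I. norm (s n i - restrict l I i) < e)"
        using mem by (auto elim: eventually_mono)
    qed
    then show "\<exists>l. limitin mtopology s l sequentially" by blast
  qed
  then show ?thesis
    using assms Metric_space_axioms unfolding banach_product_def by blast
qed

text \<open>Isolates the algebra from which all the topological claims follow. It is instantiated
  twice, with the projections on the domain and with those on the codomain.\<close>

locale resolution_of_identity =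
  fixes I :: "'i set" and T :: "'i \<Rightarrow> ('a::complex_banach \<Rightarrow>\<^sub>L 'a)"
  assumes fin: "finite I" and nonempty: "I \<noteq> {}"
    and clinear: "\<And>i. i \<in> I \<Longrightarrow> T i \<in> cblinfuns"
    and idem: "\<And>i. i \<in> I \<Longrightarrow> T i o\<^sub>L T i = T i"
    and orth: "\<And>i j. i \<in> I \<Longrightarrow> j \<in> I \<Longrightarrow> i \<noteq> j \<Longrightarrow> T i o\<^sub>L T j = 0"
    and sum_id: "(\<Sum>i\<in>I. T i) = id_blinfun"
begin

lemma subspaces:
  assumes "i \<in> I"
  shows "csubspace (range (T i))" "closed (range (T i))" "complete (range (T i))"
  using csubspace_range[OF clinear[OF assms]] closed_range_idempotent[OF idem[OF assms]]
  by (simp_all add: complete_eq_closed)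

lemma sum_apply: "(\<Sum>i\<in>I. T i x) = x"
  using arg_cong[OF sum_id, of "\<lambda>S. blinfun_apply S x"] by (simp add: blinfun.sum_left)

lemma apply_sum:
  assumes f: "f \<in> (\<Pi>\<^sub>E i\<in>I. range (T i))" and j: "j \<in> I"
  shows "T j (\<Sum>i\<in>I. f i) = f j"
proof -
  have "T j (f i) = (if i = j then f j else 0)" if i: "i \<in> I" for i
  proof -
    obtain x where x: "f i = T i x"
      using f i by blast
    have "T j o\<^sub>L T i = (if i = j then T i else 0)"
      using idem orth i j by auto
    then have "(T j o\<^sub>L T i) x = (if i = j then T i else 0) x"
      by (rule arg_cong)
    then show ?thesis
      using x by (auto split: if_splits)
  qed
  then have "T j (\<Sum>i\<in>I. f i) = (\<Sum>i\<in>I. if i = j then f j else 0)"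
    by (simp add: blinfun.sum_right)
  then show ?thesis
    using fin j by simp
qed

lemma coords_sum:
  assumes "f \<in> (\<Pi>\<^sub>E i\<in>I. range (T i))"
  shows "(\<lambda>j\<in>I. T j (\<Sum>i\<in>I. f i)) = f"
  using assms apply_sum[OF assms] by (intro PiE_ext[of _ I "\<lambda>i. range (T i)"]) auto

text \<open>Summation has the coordinate map \<open>x \<mapsto> (T i x)\<close> as inverse. Both are
  continuous, the latter because each \<open>T i\<close> is bounded.\<close>

lemma direct_sum: "topological_direct_sum I (\<lambda>i. range (T i))"
  unfolding topological_direct_sum_def
proof (intro conjI ballI allI)
  fix x
  show "\<exists>!f. f \<in> (\<Pi>\<^sub>E i\<in>I. range (T i)) \<and> x = (\<Sum>i\<in>I. f i)"
  proof
    show "(\<lambda>i\<in>I. T i x) \<in> (\<Pi>\<^sub>E i\<in>I. range (T i)) \<and> x = (\<Sum>i\<in>I. (\<lambda>i\<in>I. T i x) i)"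
      by (simp add: sum_apply)
  qed (use coords_sum in auto)
next
  let ?top = "product_topology (\<lambda>i. top_of_set (range (blinfun_apply (T i)))) I"
  have "continuous_map ?top euclidean (\<lambda>f. f i)" if i: "i \<in> I" for i
    using continuous_map_product_projection[OF i, of "\<lambda>i. top_of_set (range (blinfun_apply (T i)))"]
    by (simp add: continuous_map_in_subtopology)
  then have "continuous_map ?top euclidean (\<lambda>f. \<Sum>i\<in>I. f i)"
    by (intro continuous_map_sum[OF fin]) auto
  moreover have "continuous_map euclidean ?top (\<lambda>x. \<lambda>i\<in>I. T i x)"
    unfolding continuous_map_componentwise
    by (auto simp: continuous_map_in_subtopology intro!: continuous_intros)
  ultimately have "homeomorphic_maps ?top euclidean (\<lambda>f. \<Sum>i\<in>I. f i) (\<lambda>x. \<lambda>i\<in>I. T i x)"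
    unfolding homeomorphic_maps_def using coords_sum by (simp add: sum_apply)
  then show "homeomorphic_map ?top euclidean (\<lambda>f. \<Sum>i\<in>I. f i)"
    using homeomorphic_maps_map by blast
qed (use fin subspaces in auto)

lemma product_isomorphism:
  "banach_product_isomorphism I (\<lambda>i. range (T i)) (\<lambda>x. \<lambda>i\<in>I. T i x) (\<lambda>f. \<Sum>i\<in>I. f i)"
  unfolding banach_product_isomorphism_def
proof (intro conjI allI ballI)
  show "banach_product I (\<lambda>i. range (T i))"
    using fin nonempty subspaces by (intro banach_product_closed)
  show "bij_betw (\<lambda>x. \<lambda>i\<in>I. T i x) UNIV (\<Pi>\<^sub>E i\<in>I. range (T i))"
    by (rule bij_betw_byWitness[where f' = "\<lambda>f. \<Sum>i\<in>I. f i"])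
      (use coords_sum in \<open>auto simp: sum_apply\<close>)
  show "(\<Sum>i\<in>I. (\<lambda>i\<in>I. T i x) i) = x" for x
    by (simp add: sum_apply)
  show "(\<lambda>i\<in>I. T i (\<Sum>i\<in>I. f i)) = f" if "f \<in> (\<Pi>\<^sub>E i\<in>I. range (T i))" for f
    using coords_sum[OF that] .
  show "(\<lambda>i\<in>I. T i (x + y)) = (\<lambda>i\<in>I. (\<lambda>i\<in>I. T i x) i + (\<lambda>i\<in>I. T i y) i)" for x y
    by (auto simp: blinfun.add_right)
  show "(\<lambda>i\<in>I. T i (c *\<^sub>C x)) = (\<lambda>i\<in>I. c *\<^sub>C (\<lambda>i\<in>I. T i x) i)" for c x
    using clinear by (auto simp: cblinfuns_def restrict_def fun_eq_iff)
  have "max_norm I (\<lambda>i\<in>I. T i x) \<le> (\<Sum>i\<in>I. norm (T i)) * norm x" for x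
    unfolding max_norm_le_iff[OF fin nonempty]
  proof
    fix i assume i: "i \<in> I"
    have "norm (T i x) \<le> norm (T i) * norm x"
      by (rule norm_blinfun)
    also have "\<dots> \<le> (\<Sum>i\<in>I. norm (T i)) * norm x"
      by (intro mult_right_mono member_le_sum i fin) auto
    finally show "norm ((\<lambda>i\<in>I. T i x) i) \<le> (\<Sum>i\<in>I. norm (T i)) * norm x"
      using i by simp
  qed
  then show "\<exists>C. \<forall>x. max_norm I (\<lambda>i\<in>I. T i x) \<le> C * norm x" by blast
  have "norm (\<Sum>i\<in>I. f i) \<le> real (card I) * max_norm I f" for f :: "'i \<Rightarrow> 'a"
    using fin max_norm_ge by (intro sum_norm_le[THEN order_trans, OF _ sum_bounded_above]) auto
  then show "\<exists>C. \<forall>f\<in>(\<Pi>\<^sub>E i\<in>I. range (T i)). norm (\<Sum>i\<in>I. f i) \<le> C * max_norm I f" by blast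
qed

end

section \<open>Recursions for Laurent coefficients of an inverse\<close>

lemma blinfun_compose_assoc: "(f o\<^sub>L g) o\<^sub>L h = f o\<^sub>L (g o\<^sub>L h)"
  by (rule blinfun_eqI) simp

lemma blinfun_compose_id [simp]: "f o\<^sub>L id_blinfun = f" "id_blinfun o\<^sub>L f = f"
  by (rule blinfun_eqI, simp)+

lemmas blinfun_compose_simps =
  bounded_bilinear.add_left[OF bounded_bilinear_blinfun_compose]
  bounded_bilinear.add_right[OF bounded_bilinear_blinfun_compose]
  bounded_bilinear.diff_left[OF bounded_bilinear_blinfun_compose]
  bounded_bilinear.diff_right[OF bounded_bilinear_blinfun_compose]
  bounded_bilinear.minus_left[OF bounded_bilinear_blinfun_compose]
  bounded_bilinear.minus_right[OF bounded_bilinear_blinfun_compose]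

lemmas blinfun_compose_sum_left = bounded_bilinear.sum_left[OF bounded_bilinear_blinfun_compose]
lemmas blinfun_compose_sum_right = bounded_bilinear.sum_right[OF bounded_bilinear_blinfun_compose]

lemma scaleC_one [simp]: "1 *\<^sub>C x = x"
  using scaleR_scaleC[of 1 x] by simp

lemma bounded_bilinear_scaleC:
  "bounded_bilinear (scaleC :: complex \<Rightarrow> 'a::complex_normed_vector \<Rightarrow> 'a)"
proof
  show "(r *\<^sub>R c) *\<^sub>C x = r *\<^sub>R (c *\<^sub>C x)" for r c and x :: 'a
    by (simp add: scaleR_scaleC scaleC_scaleC scaleC_complex_def)
  show "c *\<^sub>C (r *\<^sub>R x) = r *\<^sub>R (c *\<^sub>C x)" for r c and x :: 'a
    by (simp add: scaleR_scaleC scaleC_scaleC mult.commute)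
  show "\<exists>K. \<forall>c (x::'a). norm (c *\<^sub>C x) \<le> norm c * norm x * K"
    by (rule exI[of _ 1]) (simp add: norm_scaleC)
qed (simp_all add: scaleC_add_left scaleC_add_right)

interpretation scaleC: bounded_bilinear scaleC
  by (rule bounded_bilinear_scaleC)

lemma scaleC_compose_left: "(c *\<^sub>C f) o\<^sub>L g = c *\<^sub>C (f o\<^sub>L g)"
  by (rule blinfun_eqI) (simp add: scaleC_blinfun.rep_eq)

lemma scaleC_compose_right: "f \<in> cblinfuns \<Longrightarrow> f o\<^sub>L (c *\<^sub>C g) = c *\<^sub>C (f o\<^sub>L g)"
  by (rule blinfun_eqI) (simp add: scaleC_blinfun.rep_eq cblinfuns_def)

lemma cblinfuns_compose: "f \<in> cblinfuns \<Longrightarrow> g \<in> cblinfuns \<Longrightarrow> f o\<^sub>L g \<in> cblinfuns"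
  by (simp add: cblinfuns_def)

lemma cblinfuns_scaleC: "f \<in> cblinfuns \<Longrightarrow> c *\<^sub>C f \<in> cblinfuns"
  by (simp add: cblinfuns_def scaleC_blinfun.rep_eq scaleC_scaleC mult.commute)

lemma cblinfuns_add: "f \<in> cblinfuns \<Longrightarrow> g \<in> cblinfuns \<Longrightarrow> f + g \<in> cblinfuns"
  by (simp add: cblinfuns_def blinfun.add_left scaleC_add_right)

lemma cblinfuns_diff: "f \<in> cblinfuns \<Longrightarrow> g \<in> cblinfuns \<Longrightarrow> f - g \<in> cblinfuns"
  by (simp add: cblinfuns_def blinfun.diff_left scaleC.diff_right)

lemma cblinfuns_id: "id_blinfun \<in> cblinfuns"
  by (simp add: cblinfuns_def)

lemma cblinfuns_0: "0 \<in> cblinfuns"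
  by (simp add: cblinfuns_def scaleC.zero_right)

lemma cblinfuns_sum: "(\<And>i. i \<in> I \<Longrightarrow> f i \<in> cblinfuns) \<Longrightarrow> (\<Sum>i\<in>I. f i) \<in> cblinfuns"
  by (induction I rule: infinite_finite_induct) (auto intro: cblinfuns_0 cblinfuns_add)

text \<open>The coefficientwise form of \<open>(\<Sum>j. z\<^sup>j c\<^sub>j) (B + z A) = 1\<close> and \<open>(B + z A) (\<Sum>j. z\<^sup>j c\<^sub>j) = 1\<close>.\<close>

definition inverse_coeffs ::
  "('x::real_normed_vector \<Rightarrow>\<^sub>L 'y::real_normed_vector) \<Rightarrow> ('x \<Rightarrow>\<^sub>L 'y) \<Rightarrow> (int \<Rightarrow> ('y \<Rightarrow>\<^sub>L 'x)) \<Rightarrow> bool"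
  where "inverse_coeffs B A c \<longleftrightarrow>
    (\<forall>j. (c j o\<^sub>L B) + (c (j - 1) o\<^sub>L A) = (if j = 0 then id_blinfun else 0) \<and>
         (B o\<^sub>L c j) + (A o\<^sub>L c (j - 1)) = (if j = 0 then id_blinfun else 0))"

lemma inverse_coeffs_left:
  "inverse_coeffs B A c \<Longrightarrow> c (j - 1) o\<^sub>L A = (if j = 0 then id_blinfun else 0) - (c j o\<^sub>L B)"
  unfolding inverse_coeffs_def eq_diff_eq by (metis add.commute)

lemma inverse_coeffs_right:
  "inverse_coeffs B A c \<Longrightarrow> A o\<^sub>L c (j - 1) = (if j = 0 then id_blinfun else 0) - (B o\<^sub>L c j)"
  unfolding inverse_coeffs_def eq_diff_eq by (metis add.commute)

text \<open>The two relations of index \<open>-1\<close> turn both sides into the negative of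
  \<open>A o\<^sub>L c (-2) o\<^sub>L A\<close>.\<close>

lemma inverse_coeffs_intertwine:
  assumes "inverse_coeffs B A c"
  shows "A o\<^sub>L c (-1) o\<^sub>L B = B o\<^sub>L (c (-1) o\<^sub>L A)"
proof -
  have l: "c (-1) o\<^sub>L B = - (c (-2) o\<^sub>L A)"
    using inverse_coeffs_left[OF assms, of "-1"] by simp
  have r: "B o\<^sub>L c (-1) = - (A o\<^sub>L c (-2))"
    using inverse_coeffs_right[OF assms, of "-1"] by simp
  have "A o\<^sub>L c (-1) o\<^sub>L B = A o\<^sub>L (c (-1) o\<^sub>L B)"
    by (rule blinfun_compose_assoc)
  also have "\<dots> = B o\<^sub>L c (-1) o\<^sub>L A"
    unfolding l r by (simp add: blinfun_compose_simps blinfun_compose_assoc)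
  finally show ?thesis
    by (simp add: blinfun_compose_assoc)
qed

text \<open>This is the resolvent identity \<open>R(z) - R(w) = (w - z) R(z) A R(w)\<close> with
  \<open>w = \<delta> + v\<close>, read off at \<open>z^a v^b\<close>, where \<open>c\<close>
  expands \<open>R\<close> at \<open>0\<close> and \<open>d\<close> expands it at
  \<open>\<delta>\<close>. The derivation is purely algebraic:
  \<open>c a o\<^sub>L B o\<^sub>L d b\<close> is evaluated through the left relation for
  \<open>c\<close> and the right relation for \<open>d\<close>, and then cancels.\<close>

lemma inverse_coeffs_product_rec:
  assumes "inverse_coeffs B A c" "inverse_coeffs (B + \<delta> *\<^sub>C A) A d" "c a \<in> cblinfuns"
  shows "(c a o\<^sub>L A o\<^sub>L d (b - 1)) - (c (a - 1) o\<^sub>L A o\<^sub>L d b) =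
    (if b = 0 then c a else 0) - (if a = 0 then d b else 0) - \<delta> *\<^sub>C (c a o\<^sub>L A o\<^sub>L d b)"
proof -
  have "c a o\<^sub>L A o\<^sub>L d (b - 1) = c a o\<^sub>L ((if b = 0 then id_blinfun else 0) - ((B + \<delta> *\<^sub>C A) o\<^sub>L d b))"
    using inverse_coeffs_right[OF assms(2)] by (simp add: blinfun_compose_assoc)
  also have "\<dots> = (if b = 0 then c a else 0) - (c a o\<^sub>L B o\<^sub>L d b) - \<delta> *\<^sub>C (c a o\<^sub>L A o\<^sub>L d b)"
    using assms(3)
    by (simp add: blinfun_compose_simps scaleC_compose_left scaleC_compose_right blinfun_compose_assoc)
  finally have 1: "c a o\<^sub>L A o\<^sub>L d (b - 1) =
    (if b = 0 then c a else 0) - (c a o\<^sub>L B o\<^sub>L d b) - \<delta> *\<^sub>C (c a o\<^sub>L A o\<^sub>L d b)" .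
  have 2: "c (a - 1) o\<^sub>L A o\<^sub>L d b = (if a = 0 then d b else 0) - (c a o\<^sub>L B o\<^sub>L d b)"
    unfolding inverse_coeffs_left[OF assms(1)] by (simp add: blinfun_compose_simps)
  show ?thesis
    unfolding 1 2 by simp
qed

section \<open>Decay of Laurent coefficients and products of residues\<close>

lemma norm_compose3:
  assumes "norm f \<le> a" "norm h \<le> b"
  shows "norm (f o\<^sub>L g o\<^sub>L h) \<le> norm g * a * b"
proof -
  have "norm (f o\<^sub>L g o\<^sub>L h) \<le> norm f * norm g * norm h"
    by (meson norm_blinfun_compose mult_right_mono norm_ge_zero order_trans)
  also have "\<dots> \<le> a * norm g * b"
    using assms order_trans[OF norm_ge_zero assms(1)] by (intro mult_mono) auto
  finally show ?thesis
    by (simp add: mult_ac)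
qed

text \<open>The Cauchy estimates on the circle of radius \<open>\<rho>\<close>. They give decay in
  both index directions, at different geometric rates.\<close>

definition laurent_bound :: "(int \<Rightarrow> 'a::real_normed_vector) \<Rightarrow> real \<Rightarrow> bool" where
  "laurent_bound c \<rho> \<longleftrightarrow> (\<exists>C. \<forall>j. norm (c j) * \<rho> powi j \<le> C)"

lemma laurent_boundE:
  assumes "laurent_bound c \<rho>" "\<rho> > 0"
  obtains C where "C \<ge> 0" "\<And>n. norm (c (int n)) \<le> C * (1 / \<rho>) ^ n"
    "\<And>n. norm (c (- int n)) \<le> C * \<rho> ^ n"
proof -
  obtain C where C: "\<And>j. norm (c j) * \<rho> powi j \<le> C"
    using assms(1) unfolding laurent_bound_def by blast
  have "norm (c (int n)) \<le> C * (1 / \<rho>) ^ n" "norm (c (- int n)) \<le> C * \<rho> ^ n" for n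
    using C[of "int n"] C[of "- int n"] assms(2)
    by (simp_all add: power_int_minus power_divide field_simps)
  moreover have "C \<ge> 0"
    using C[of 0] by (simp add: order_trans[OF norm_ge_zero])
  ultimately show thesis
    using that by blast
qed

text \<open>The products \<open>c\<^sub>n A c\<^bsub>-2-n\<^esub>\<close> for \<open>n \<ge> 0\<close> do not depend on \<open>n\<close> and tend to \<open>0\<close>.\<close>

lemma residue_idempotent:
  assumes c: "inverse_coeffs B A c" "\<And>j. c j \<in> cblinfuns"
    and \<rho>: "laurent_bound c \<rho>\<^sub>1" "laurent_bound c \<rho>\<^sub>2" "0 < \<rho>\<^sub>2" "\<rho>\<^sub>2 < \<rho>\<^sub>1"
  shows "c (-1) o\<^sub>L A o\<^sub>L c (-1) = c (-1)"
proof -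
  define M where "M a b = c a o\<^sub>L A o\<^sub>L c b" for a b
  have rec: "M a (b - 1) - M (a - 1) b = (if b = 0 then c a else 0) - (if a = 0 then c b else 0)" for a b
    using inverse_coeffs_product_rec[where \<delta> = 0 and d = c, OF c(1)] c
    unfolding M_def by (simp add: scaleC.zero_left)
  \<comment> \<open>Going from \<open>n\<close> to \<open>n + 1\<close> uses the recursion at
    \<open>a = n + 1\<close>, \<open>b = -(n + 2)\<close>, where both indicator terms
    vanish.\<close>
  have const: "M (int n) (- int (n + 2)) = M 0 (-2)" for n
  proof (induction n)
    case (Suc n)
    then show ?case
      using rec[of "int (Suc n)" "- int (n + 2)"] by (simp add: algebra_simps)
  qed simp
  obtain C\<^sub>1 where C1: "C\<^sub>1 \<ge> 0" "\<And>n. norm (c (int n)) \<le> C\<^sub>1 * (1 / \<rho>\<^sub>1) ^ n"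
    using laurent_boundE[OF \<rho>(1)] \<rho> by (metis order_less_trans)
  obtain C\<^sub>2 where C2: "C\<^sub>2 \<ge> 0" "\<And>n. norm (c (- int n)) \<le> C\<^sub>2 * \<rho>\<^sub>2 ^ n"
    using laurent_boundE[OF \<rho>(2)] \<rho> by metis
  \<comment> \<open>The nonnegative index is estimated at the larger radius and the negative one at
    the smaller radius, so that the product decays like
    \<open>(\<rho>\<^sub>2 / \<rho>\<^sub>1) ^ n\<close>.\<close>
  have "norm (M 0 (-2)) \<le> norm A * C\<^sub>1 * C\<^sub>2 * \<rho>\<^sub>2\<^sup>2 * (\<rho>\<^sub>2 / \<rho>\<^sub>1) ^ n" for n
  proof -
    have "norm (M 0 (-2)) \<le> norm A * (C\<^sub>1 * (1 / \<rho>\<^sub>1) ^ n) * (C\<^sub>2 * \<rho>\<^sub>2 ^ (n + 2))"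
      using norm_compose3[OF C1(2) C2(2), of n A "n + 2"] const[of n] unfolding M_def by simp
    then show ?thesis
      by (simp add: power_add power_divide mult_ac power2_eq_square)
  qed
  moreover have "(\<lambda>n. norm A * C\<^sub>1 * C\<^sub>2 * \<rho>\<^sub>2\<^sup>2 * (\<rho>\<^sub>2 / \<rho>\<^sub>1) ^ n) \<longlonglongrightarrow> 0"
    using \<rho> by (intro tendsto_mult_right_zero LIMSEQ_power_zero) auto
  ultimately have "norm (M 0 (-2)) \<le> 0"
    by (meson LIMSEQ_le_const)
  \<comment> \<open>At \<open>a = 0\<close>, \<open>b = -1\<close> the indicator of \<open>a\<close>
    contributes \<open>c (-1)\<close>, while \<open>M 0 (-2)\<close> has just been shown to
    vanish.\<close>
  then have "M (-1) (-1) = c (-1)"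
    using rec[of 0 "-1"] by simp
  then show ?thesis
    unfolding M_def .
qed

text \<open>Unfolding the recursion \<open>n\<close> times improves the a priori bound
  \<open>w\<close> by the factor \<open>\<theta> ^ n\<close>. The weight \<open>w\<close> may grow
  or shrink along the two moves \<open>f\<close> and \<open>g\<close>; only the combined contraction
  matters. Below, the states are index pairs.\<close>

lemma contracting_recursion_zero:
  fixes u w :: "'s \<Rightarrow> real"
  assumes rec: "\<And>s. u s \<le> \<alpha> * u (f s) + \<beta> * u (g s)"
    and bound: "\<And>s. u s \<le> w s"
    and contr: "\<And>s. \<alpha> * w (f s) + \<beta> * w (g s) \<le> \<theta> * w s"
    and pos: "0 \<le> \<alpha>" "0 \<le> \<beta>" "0 \<le> \<theta>" "\<theta> < 1"
  shows "u s \<le> 0"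
proof -
  have "u s \<le> \<theta> ^ n * w s" for n s
  proof (induction n arbitrary: s)
    case 0
    then show ?case using bound by simp
  next
    case (Suc n)
    have "u s \<le> \<alpha> * (\<theta> ^ n * w (f s)) + \<beta> * (\<theta> ^ n * w (g s))"
      by (rule order_trans[OF rec]) (intro add_mono mult_left_mono Suc pos)
    also have "\<dots> = \<theta> ^ n * (\<alpha> * w (f s) + \<beta> * w (g s))"
      by (simp add: algebra_simps)
    also have "\<dots> \<le> \<theta> ^ n * (\<theta> * w s)"
      using contr pos by (intro mult_left_mono) auto
    finally show ?case by (simp add: mult_ac)
  qed
  moreover have "(\<lambda>n. \<theta> ^ n * w s) \<longlonglongrightarrow> 0"
    using pos by (intro tendsto_mult_left_zero LIMSEQ_power_zero) auto
  ultimately show ?thesis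
    by (meson LIMSEQ_le_const)
qed

text \<open>When both indices are negative the product recursion has no indicator terms and
  expresses \<open>\<delta> *\<^sub>C M i k\<close> through the two neighbours with one index
  lowered further. The decay of both principal parts then forces all these products to
  vanish.\<close>

lemma residues_orthogonal:
  assumes c: "inverse_coeffs B A c" "\<And>j. c j \<in> cblinfuns"
    and d: "inverse_coeffs (B + \<delta> *\<^sub>C A) A d"
    and \<rho>: "laurent_bound c \<rho>" "laurent_bound d \<rho>" "0 < \<rho>" "2 * \<rho> < cmod \<delta>"
  shows "c (-1) o\<^sub>L A o\<^sub>L d (-1) = 0"
proof -
  define M where "M i k = c (-1 - int i) o\<^sub>L A o\<^sub>L d (-1 - int k)" for i k
  have \<delta>: "\<delta> \<noteq> 0" using \<rho> by auto
  have "\<delta> *\<^sub>C M i k = M (Suc i) k - M i (Suc k)" for i k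
    using inverse_coeffs_product_rec[OF c(1) d c(2), of "-1 - int i" "-1 - int k"]
    unfolding M_def by (simp add: algebra_simps)
  then have "cmod \<delta> * norm (M i k) \<le> norm (M (Suc i) k) + norm (M i (Suc k))" for i k
    by (metis norm_scaleC norm_triangle_ineq4)
  then have rec: "norm (M i k) \<le> 1 / cmod \<delta> * norm (M (Suc i) k) + 1 / cmod \<delta> * norm (M i (Suc k))" for i k
    using \<delta> by (simp add: field_simps)
  obtain C where C: "C \<ge> 0" "\<And>n. norm (c (- int n)) \<le> C * \<rho> ^ n"
    using laurent_boundE[OF \<rho>(1)] \<rho> by metis
  obtain D where D: "D \<ge> 0" "\<And>n. norm (d (- int n)) \<le> D * \<rho> ^ n"
    using laurent_boundE[OF \<rho>(2)] \<rho> by metis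
  have bound: "norm (M i k) \<le> norm A * (C * \<rho> ^ Suc i) * (D * \<rho> ^ Suc k)" for i k
    unfolding M_def using C(2)[of "Suc i"] D(2)[of "Suc k"] by (intro norm_compose3) simp_all
  \<comment> \<open>Each move multiplies the weight by \<open>\<rho>\<close> and there are two of
    them with coefficient \<open>1 / cmod \<delta>\<close>, hence the ratio
    \<open>2 * \<rho> / cmod \<delta>\<close>.\<close>
  have "norm (case (0, 0) of (i, k) \<Rightarrow> M i k) \<le> 0"
  proof (rule contracting_recursion_zero[where f = "\<lambda>(i, k). (Suc i, k)" and g = "\<lambda>(i, k). (i, Suc k)"
        and \<alpha> = "1 / cmod \<delta>" and \<beta> = "1 / cmod \<delta>" and \<theta> = "2 * \<rho> / cmod \<delta>"
        and w = "\<lambda>(i, k). norm A * (C * \<rho> ^ Suc i) * (D * \<rho> ^ Suc k)"])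
    show "2 * \<rho> / cmod \<delta> < 1"
      using \<rho> by (simp add: divide_less_eq)
  qed (use rec bound \<rho> in \<open>auto simp: field_simps\<close>)
  then show ?thesis
    by (simp add: M_def)
qed

text \<open>Here \<open>c\<close> is controlled at a radius enclosing the disc of radius
  \<open>\<epsilon>\<close> around \<open>\<delta>\<close>, as for the expansion at infinity.
  Nonnegative indices of \<open>c\<close> against negative ones of \<open>d\<close> give a recursion
  without indicator terms; one move gains \<open>\<epsilon> / \<rho>\<close>, the other
  \<open>cmod \<delta> / \<rho>\<close>.\<close>

lemma outer_residue_absorbs:
  assumes c: "inverse_coeffs B A c" "\<And>j. c j \<in> cblinfuns"
    and d: "inverse_coeffs (B + \<delta> *\<^sub>C A) A d"
    and \<rho>: "laurent_bound c \<rho>" "laurent_bound d \<epsilon>" "0 < \<epsilon>" "\<epsilon> + cmod \<delta> < \<rho>"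
  shows "c (-1) o\<^sub>L A o\<^sub>L d (-1) = d (-1)"
proof -
  define M where "M i k = c (int i) o\<^sub>L A o\<^sub>L d (-1 - int k)" for i k
  have \<rho>0: "\<rho> > 0" using \<rho> norm_ge_zero[of \<delta>] by linarith
  have "M i k = M (Suc i) (Suc k) + \<delta> *\<^sub>C M (Suc i) k" for i k
    using inverse_coeffs_product_rec[OF c(1) d c(2), of "int (Suc i)" "-1 - int k"]
    unfolding M_def by (simp add: algebra_simps)
  then have rec: "norm (M i k) \<le> 1 * norm (M (Suc i) (Suc k)) + cmod \<delta> * norm (M (Suc i) k)" for i k
    by (metis norm_scaleC norm_triangle_ineq mult_1)
  obtain C where C: "C \<ge> 0" "\<And>n. norm (c (int n)) \<le> C * (1 / \<rho>) ^ n"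
    using laurent_boundE[OF \<rho>(1) \<rho>0] by metis
  obtain D where D: "D \<ge> 0" "\<And>n. norm (d (- int n)) \<le> D * \<epsilon> ^ n"
    using laurent_boundE[OF \<rho>(2)] \<rho> by metis
  have bound: "norm (M i k) \<le> norm A * (C * (1 / \<rho>) ^ i) * (D * \<epsilon> ^ Suc k)" for i k
    unfolding M_def using C(2)[of "i"] D(2)[of "Suc k"] by (intro norm_compose3) simp_all
  have "norm (case (0, k) of (i, k) \<Rightarrow> M i k) \<le> 0" for k
  proof (rule contracting_recursion_zero[where f = "\<lambda>(i, k). (Suc i, Suc k)" and g = "\<lambda>(i, k). (Suc i, k)"
        and \<alpha> = 1 and \<beta> = "cmod \<delta>" and \<theta> = "(\<epsilon> + cmod \<delta>) / \<rho>"
        and w = "\<lambda>(i, k). norm A * (C * (1 / \<rho>) ^ i) * (D * \<epsilon> ^ Suc k)"])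
  qed (use rec bound \<rho> \<rho>0 in \<open>auto simp: field_simps\<close>)
  \<comment> \<open>These two entries occur in the recursion at \<open>a = 0\<close>,
    \<open>b = -1\<close>, where the indicator of \<open>a\<close> brings in
    \<open>d (-1)\<close>.\<close>
  then have "M 0 0 = 0" "M 0 1 = 0"
    by (force, force)
  then show ?thesis
    using inverse_coeffs_product_rec[OF c(1) d c(2), of 0 "-1"]
    unfolding M_def by (simp add: scaleC.zero_right)
qed

section \<open>Vector-valued Laurent series\<close>

text \<open>Terms of an unconditionally convergent family are bounded: outside a suitable finite set
  \<open>X\<close>, a term is the difference of two partial sums that both lie within
  \<open>1\<close> of the limit.\<close>

lemma has_sum_laurent_bound:
  assumes "((\<lambda>j. (z powi j) *\<^sub>C c j) has_sum s) UNIV"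
  shows "laurent_bound c (cmod z)"
proof -
  let ?f = "\<lambda>j. (z powi j) *\<^sub>C c j"
  have "\<forall>\<^sub>F X in finite_subsets_at_top UNIV. dist (sum ?f X) s < 1"
    using assms unfolding has_sum_def by (rule tendstoD) simp
  then obtain X where X: "finite X" "\<And>Y. finite Y \<Longrightarrow> X \<subseteq> Y \<Longrightarrow> dist (sum ?f Y) s < 1"
    unfolding eventually_finite_subsets_at_top by auto
  have "norm (?f j) \<le> 2 + (\<Sum>i\<in>X. norm (?f i))" for j
  proof (cases "j \<in> X")
    case True
    then have "norm (?f j) \<le> (\<Sum>i\<in>X. norm (?f i))"
      using X(1) by (intro member_le_sum) auto
    then show ?thesis by linarith
  next
    case False
    then have "norm (?f j) = dist (sum ?f (insert j X)) (sum ?f X)"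
      using X(1) by (simp add: dist_norm)
    also have "\<dots> \<le> dist (sum ?f (insert j X)) s + dist (sum ?f X) s"
      by (rule dist_triangle2)
    also have "\<dots> \<le> 2"
      using X(2)[of "insert j X", OF _ subset_insertI] X(2)[of X] X(1) by auto
    finally show ?thesis
      using sum_nonneg[of X "\<lambda>i. norm (?f i)"] by auto
  qed
  then show ?thesis
    unfolding laurent_bound_def norm_scaleC norm_power_int by (metis mult.commute)
qed

text \<open>The negative indices are dominated by a geometric series with ratio
  \<open>\<rho>\<^sub>1 / \<rho>\<close>, the nonnegative ones by one with ratio
  \<open>\<rho> / \<rho>\<^sub>2\<close>.\<close>

lemma laurent_bound_summable:
  fixes c :: "int \<Rightarrow> 'a::real_normed_vector"
  assumes "laurent_bound c \<rho>\<^sub>1" "laurent_bound c \<rho>\<^sub>2" "0 < \<rho>\<^sub>1" "\<rho>\<^sub>1 < \<rho>" "\<rho> < \<rho>\<^sub>2"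
  shows "(\<lambda>j. norm (c j) * \<rho> powi j) summable_on UNIV"
proof -
  let ?f = "\<lambda>j. norm (c j) * \<rho> powi j"
  have geom: "(\<lambda>n. C * q ^ n) summable_on UNIV" if "0 \<le> q" "q < 1" "0 \<le> C" for C q :: real
    using that by (intro summable_nonneg_imp_summable_on summable_mult summable_geometric) auto
  obtain C\<^sub>1 where C1: "C\<^sub>1 \<ge> 0" "\<And>n. norm (c (- int n)) \<le> C\<^sub>1 * \<rho>\<^sub>1 ^ n"
    using laurent_boundE[OF assms(1,3)] by metis
  obtain C\<^sub>2 where C2: "C\<^sub>2 \<ge> 0" "\<And>n. norm (c (int n)) \<le> C\<^sub>2 * (1 / \<rho>\<^sub>2) ^ n"
    using laurent_boundE[OF assms(2)] assms by (metis order_less_trans)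
  have "?f summable_on range int"
  proof (subst summable_on_reindex)
    show "?f \<circ> int summable_on UNIV"
    proof (rule summable_on_comparison_test[OF geom])
      show "(?f \<circ> int) n \<le> C\<^sub>2 * (\<rho> / \<rho>\<^sub>2) ^ n" for n
        using mult_right_mono[OF C2(2)[of n], of "\<rho> ^ n"] assms
        by (simp add: power_divide mult_ac)
    qed (use assms C2 in auto)
  qed (simp add: inj_on_def)
  moreover have "?f summable_on range (\<lambda>n. - int n)"
  proof (subst summable_on_reindex)
    show "?f \<circ> (\<lambda>n. - int n) summable_on UNIV"
    proof (rule summable_on_comparison_test[OF geom])
      show "(?f \<circ> (\<lambda>n. - int n)) n \<le> C\<^sub>1 * (\<rho>\<^sub>1 / \<rho>) ^ n" for n
        using mult_right_mono[OF C1(2)[of n], of "1 / \<rho> ^ n"] assms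
        by (simp add: power_divide mult_ac power_int_minus field_simps)
    qed (use assms C1 in auto)
  qed (simp add: inj_on_def)
  ultimately have "?f summable_on (range int \<union> range (\<lambda>n. - int n))"
    by (rule summable_on_union)
  moreover have "range int \<union> range (\<lambda>n. - int n) = UNIV"
    by (auto intro: int_cases2)
  ultimately show ?thesis by simp
qed

lemma has_integral_cis_powi:
  "((\<lambda>t. cis t powi j) has_integral (if j = 0 then of_real (2 * pi) else 0)) {0..2 * pi}"
proof (cases "j = 0")
  case True
  then show ?thesis
    using has_integral_const_real[of "1::complex" 0 "2 * pi"] by (simp add: scaleR_conv_of_real)
next
  case False
  define F where "F t = cis (of_int j * t) / (\<i> * of_int j)" for t
  have "(F has_vector_derivative cis t powi j) (at t within {0..2 * pi})" for t
    unfolding F_def cis_power_int has_vector_derivative_def using False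
    by (auto intro!: derivative_eq_intros simp: scaleR_conv_of_real fun_eq_iff field_simps)
  then have "((\<lambda>t. cis t powi j) has_integral (F (2 * pi) - F 0)) {0..2 * pi}"
    by (intro fundamental_theorem_of_calculus) auto
  moreover have "F (2 * pi) = F 0"
    unfolding F_def using cis_multiple_2pi[of "of_int j"] by (simp add: mult.commute)
  ultimately show ?thesis
    using False by simp
qed

text \<open>The series converges uniformly on the circle by the Weierstrass test, so it may be
  integrated termwise, and only the term \<open>j = m\<close> survives. Integrating in the angle
  instead of \<open>z\<close> absorbs one power of \<open>z\<close>, which is why the exponent is
  \<open>- m\<close> and not \<open>- m - 1\<close>.\<close>

lemma has_integral_laurent_coeff:
  fixes c :: "int \<Rightarrow> 'a::{complex_normed_vector, banach}"
  assumes \<rho>: "\<rho> > 0" and summable: "(\<lambda>j. norm (c j) * \<rho> powi j) summable_on UNIV"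
    and sum: "\<And>z. cmod z = \<rho> \<Longrightarrow> ((\<lambda>j. (z powi j) *\<^sub>C c j) has_sum f z) UNIV"
  shows "((\<lambda>t. ((of_real \<rho> * cis t) powi (- m)) *\<^sub>C f (of_real \<rho> * cis t)) has_integral
    (2 * pi) *\<^sub>R c m) {0..2 * pi}"
proof -
  define z where "z t = of_real \<rho> * cis t" for t
  have z: "cmod (z t) = \<rho>" "z t \<noteq> 0" for t
    using \<rho> by (auto simp: z_def norm_mult)
  define h where "h j t = ((z t) powi (j - m)) *\<^sub>C c j" for j t
  have h_eq: "h j t = ((z t) powi (- m)) *\<^sub>C ((z t) powi j) *\<^sub>C c j" for j t
    unfolding h_def scaleC_scaleC using z(2)[of t] by (simp flip: power_int_add)
  have "uniform_limit {0..2 * pi} (\<lambda>X t. \<Sum>j\<in>X. h j t)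
      (\<lambda>t. ((z t) powi (- m)) *\<^sub>C f (z t)) (finite_subsets_at_top UNIV)"
  proof (rule Weierstrass_m_test_general')
    show "norm (h j t) \<le> \<rho> powi (- m) * (norm (c j) * \<rho> powi j)" for j t
      unfolding h_eq norm_scaleC norm_power_int z by (simp add: mult_ac)
    show "((\<lambda>j. h j t) has_sum ((z t) powi (- m)) *\<^sub>C f (z t)) UNIV" for t
      unfolding h_eq
      by (rule has_sum_bounded_linear[OF bounded_linear_scaleC_right sum[OF z(1)]])
    show "(\<lambda>j. \<rho> powi (- m) * (norm (c j) * \<rho> powi j)) summable_on UNIV"
      by (rule summable_on_cmult_right[OF summable])
  qed
  moreover have int_h: "(h j has_integral (if j = m then (2 * pi) *\<^sub>R c m else 0)) {0..2 * pi}" for j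
  proof -
    have "bounded_linear (\<lambda>w::complex. w *\<^sub>C (of_real \<rho> powi (j - m)) *\<^sub>C c j)"
      by (rule scaleC.bounded_linear_left)
    from has_integral_linear[OF has_integral_cis_powi this, of "j - m"]
    show ?thesis
      unfolding h_def z_def o_def power_int_mult_distrib
      by (cases "j = m") (simp_all add: scaleC_scaleC mult_ac scaleR_scaleC scaleC.zero_left)
  qed
  moreover have "continuous_on {0..2 * pi} (\<lambda>t. \<Sum>j\<in>X. h j t)" for X
    unfolding h_def using z(2)
    by (intro continuous_on_sum scaleC.continuous_on continuous_on_const continuous_on_power_int)
      (auto simp: z_def intro!: continuous_intros)
  ultimately obtain IX J where J: "\<And>X. ((\<lambda>t. \<Sum>j\<in>X. h j t) has_integral IX X) {0..2 * pi}"
      "((\<lambda>t. ((z t) powi (- m)) *\<^sub>C f (z t)) has_integral J) {0..2 * pi}"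
      "(IX \<longlongrightarrow> J) (finite_subsets_at_top UNIV)"
    using uniform_limit_integral[OF _ _ finite_subsets_at_top_neq_bot] by blast
  have "IX X = (2 * pi) *\<^sub>R c m" if "finite X" "m \<in> X" for X
  proof -
    have "((\<lambda>t. \<Sum>j\<in>X. h j t) has_integral (\<Sum>j\<in>X. if j = m then (2 * pi) *\<^sub>R c m else 0)) {0..2 * pi}"
      using that(1) int_h by (intro has_integral_sum) auto
    then show ?thesis
      using J(1)[of X] that by (simp add: has_integral_unique)
  qed
  \<comment> \<open>The net of integrals is constant as soon as \<open>X\<close> contains
    \<open>m\<close>.\<close>
  then have "\<forall>\<^sub>F X in finite_subsets_at_top UNIV. IX X = (2 * pi) *\<^sub>R c m"
    unfolding eventually_finite_subsets_at_top by (intro exI[of _ "{m}"]) auto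
  then have "(IX \<longlongrightarrow> (2 * pi) *\<^sub>R c m) (finite_subsets_at_top UNIV)"
    by (rule tendsto_eventually)
  then have "J = (2 * pi) *\<^sub>R c m"
    using J(3) tendsto_unique finite_subsets_at_top_neq_bot by blast
  then show ?thesis
    using J(2) unfolding z_def by simp
qed

text \<open>Centred at \<open>0\<close> so that one notion covers both cases: \<open>r = 0\<close>
  after translation for a finite spectral point, and a bounded annulus outside all finite spectral
  points for infinity.\<close>

definition laurent_on ::
  "real \<Rightarrow> real \<Rightarrow> (int \<Rightarrow> 'a::complex_normed_vector) \<Rightarrow> (complex \<Rightarrow> 'a) \<Rightarrow> bool"
  where "laurent_on r s c f \<longleftrightarrow> 0 \<le> r \<and> r < s \<and>
    (\<forall>z. r < cmod z \<and> cmod z < s \<longrightarrow> ((\<lambda>j. (z powi j) *\<^sub>C c j) has_sum f z) UNIV)"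

lemma laurent_on_bound:
  assumes "laurent_on r s c f" "r < \<rho>" "\<rho> < s"
  shows "laurent_bound c \<rho>"
  using has_sum_laurent_bound[of "of_real \<rho>" c "f (of_real \<rho>)"] assms
  unfolding laurent_on_def by auto

lemma laurent_on_coeff_integral:
  fixes c :: "int \<Rightarrow> 'a::{complex_normed_vector, banach}"
  assumes "laurent_on r s c f" "r < \<rho>" "\<rho> < s"
  shows "((\<lambda>t. ((of_real \<rho> * cis t) powi (- m)) *\<^sub>C f (of_real \<rho> * cis t)) has_integral
    (2 * pi) *\<^sub>R c m) {0..2 * pi}"
proof (rule has_integral_laurent_coeff)
  have r: "r \<ge> 0" using assms(1) unfolding laurent_on_def by blast
  then show "\<rho> > 0" using assms(2) by linarith
  obtain \<rho>\<^sub>1 \<rho>\<^sub>2 where "r < \<rho>\<^sub>1" "\<rho>\<^sub>1 < \<rho>" "\<rho> < \<rho>\<^sub>2" "\<rho>\<^sub>2 < s"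
    using assms(2,3) dense by meson
  then show "(\<lambda>j. norm (c j) * \<rho> powi j) summable_on UNIV"
    using r by (intro laurent_bound_summable[of c \<rho>\<^sub>1 \<rho>\<^sub>2] laurent_on_bound[OF assms(1)]) auto
  show "((\<lambda>j. (z powi j) *\<^sub>C c j) has_sum f z) UNIV" if "cmod z = \<rho>" for z
    using that assms unfolding laurent_on_def by auto
qed

lemma laurent_on_unique:
  fixes c :: "int \<Rightarrow> 'a::{complex_normed_vector, banach}"
  assumes "laurent_on r s c f" "laurent_on r s d f"
  shows "c = d"
proof
  fix m
  obtain \<rho> where "r < \<rho>" "\<rho> < s"
    using assms(1) dense unfolding laurent_on_def by blast
  then have "(2 * pi) *\<^sub>R c m = (2 * pi) *\<^sub>R d m"
    using laurent_on_coeff_integral[OF assms(1)] laurent_on_coeff_integral[OF assms(2)]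
      has_integral_unique by blast
  then show "c m = d m" by simp
qed

lemma laurent_on_compose_right:
  assumes "laurent_on r s c f"
  shows "laurent_on r s (\<lambda>j. c j o\<^sub>L T) (\<lambda>z. f z o\<^sub>L T)"
  unfolding laurent_on_def
proof (intro conjI allI impI)
  fix z assume "r < cmod z \<and> cmod z < s"
  then have "((\<lambda>j. (z powi j) *\<^sub>C c j) has_sum f z) UNIV"
    using assms unfolding laurent_on_def by blast
  from has_sum_bounded_linear[OF bounded_bilinear.bounded_linear_left
      [OF bounded_bilinear_blinfun_compose, of T] this]
  show "((\<lambda>j. (z powi j) *\<^sub>C (c j o\<^sub>L T)) has_sum (f z o\<^sub>L T)) UNIV"
    by (simp add: scaleC_compose_left)
qed (use assms in \<open>auto simp: laurent_on_def\<close>)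

lemma laurent_on_compose_left:
  assumes "laurent_on r s c f" "T \<in> cblinfuns"
  shows "laurent_on r s (\<lambda>j. T o\<^sub>L c j) (\<lambda>z. T o\<^sub>L f z)"
  unfolding laurent_on_def
proof (intro conjI allI impI)
  fix z assume "r < cmod z \<and> cmod z < s"
  then have "((\<lambda>j. (z powi j) *\<^sub>C c j) has_sum f z) UNIV"
    using assms unfolding laurent_on_def by blast
  from has_sum_bounded_linear[OF bounded_bilinear.bounded_linear_right
      [OF bounded_bilinear_blinfun_compose, of T] this]
  show "((\<lambda>j. (z powi j) *\<^sub>C (T o\<^sub>L c j)) has_sum (T o\<^sub>L f z)) UNIV"
    by (simp add: scaleC_compose_right[OF assms(2)])
qed (use assms in \<open>auto simp: laurent_on_def\<close>)

lemma laurent_on_add: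
  assumes "laurent_on r s c f" "laurent_on r s d g"
  shows "laurent_on r s (\<lambda>j. c j + d j) (\<lambda>z. f z + g z)"
  using assms unfolding laurent_on_def scaleC_add_right by (auto intro: has_sum_add)

lemma laurent_on_shift:
  assumes "laurent_on r s c f"
  shows "laurent_on r s (\<lambda>j. c (j - 1)) (\<lambda>z. z *\<^sub>C f z)"
  unfolding laurent_on_def
proof (intro conjI allI impI)
  fix z assume z: "r < cmod z \<and> cmod z < s"
  then have "((\<lambda>j. (z powi j) *\<^sub>C c j) has_sum f z) UNIV"
    using assms unfolding laurent_on_def by blast
  then have "((\<lambda>j. z *\<^sub>C (z powi j) *\<^sub>C c j) has_sum z *\<^sub>C f z) UNIV"
    by (rule has_sum_bounded_linear[OF bounded_linear_scaleC_right])
  moreover have "z \<noteq> 0"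
    using z assms unfolding laurent_on_def by auto
  then have "z *\<^sub>C (z powi (j - 1)) *\<^sub>C c (j - 1) = (z powi j) *\<^sub>C c (j - 1)" for j
    by (simp add: scaleC_scaleC power_int_diff)
  ultimately show "((\<lambda>j. (z powi j) *\<^sub>C c (j - 1)) has_sum z *\<^sub>C f z) UNIV"
    by (subst has_sum_reindex_bij_witness[of UNIV "\<lambda>j. j + 1" "\<lambda>j. j - 1" UNIV
          "\<lambda>j. z *\<^sub>C (z powi j) *\<^sub>C c j" _ _ "z *\<^sub>C f z"]) auto
qed (use assms in \<open>auto simp: laurent_on_def\<close>)

lemma laurent_on_const:
  assumes "0 \<le> r" "r < s"
  shows "laurent_on r s (\<lambda>j. if j = 0 then a else 0) (\<lambda>z. a)"
  unfolding laurent_on_def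
proof (intro conjI allI impI assms)
  fix z :: complex
  show "((\<lambda>j. (z powi j) *\<^sub>C (if j = 0 then a else 0)) has_sum a) UNIV"
    by (rule has_sum_finite_neutralI[of "{0}"]) (auto simp: scaleC.zero_right)
qed

lemma laurent_on_cong:
  assumes "laurent_on r s c f" "\<And>z. r < cmod z \<Longrightarrow> cmod z < s \<Longrightarrow> f z = g z"
  shows "laurent_on r s c g"
  using assms unfolding laurent_on_def by auto

text \<open>Multiplying the series by \<open>B + z A\<close> on either side gives Laurent series of
  the constant function \<open>id_blinfun\<close>; uniqueness of coefficients yields the
  recursions.\<close>

lemma laurent_on_inverse_coeffs:
  fixes c :: "int \<Rightarrow> ('y::complex_banach \<Rightarrow>\<^sub>L 'x::complex_banach)"
  assumes c: "laurent_on r s c R" and cblin: "A \<in> cblinfuns" "B \<in> cblinfuns"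
    and inv: "\<And>z. r < cmod z \<Longrightarrow> cmod z < s \<Longrightarrow> is_bounded_inverse (B + z *\<^sub>C A) (R z)"
  shows "inverse_coeffs B A c"
proof -
  have rs: "0 \<le> r" "r < s" using c unfolding laurent_on_def by auto
  have "laurent_on r s (\<lambda>j. (c j o\<^sub>L B) + (c (j - 1) o\<^sub>L A)) (\<lambda>z. id_blinfun)"
  proof (rule laurent_on_cong)
    show "laurent_on r s (\<lambda>j. (c j o\<^sub>L B) + (c (j - 1) o\<^sub>L A)) (\<lambda>z. (R z o\<^sub>L B) + z *\<^sub>C (R z o\<^sub>L A))"
      by (intro laurent_on_add laurent_on_compose_right c
          laurent_on_shift[where c = "\<lambda>j. c j o\<^sub>L A" and f = "\<lambda>z. R z o\<^sub>L A"])
    show "(R z o\<^sub>L B) + z *\<^sub>C (R z o\<^sub>L A) = id_blinfun" if "r < cmod z" "cmod z < s" for z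
    proof -
      have "R z \<in> cblinfuns" "R z o\<^sub>L (B + z *\<^sub>C A) = id_blinfun"
        using inv[OF that] unfolding is_bounded_inverse_def by blast+
      then show ?thesis
        by (simp add: blinfun_compose_simps scaleC_compose_right)
    qed
  qed
  from laurent_on_unique[OF this laurent_on_const[OF rs]]
  have left: "(c j o\<^sub>L B) + (c (j - 1) o\<^sub>L A) = (if j = 0 then id_blinfun else 0)" for j
    by meson
  have "laurent_on r s (\<lambda>j. (B o\<^sub>L c j) + (A o\<^sub>L c (j - 1))) (\<lambda>z. id_blinfun)"
  proof (rule laurent_on_cong)
    show "laurent_on r s (\<lambda>j. (B o\<^sub>L c j) + (A o\<^sub>L c (j - 1))) (\<lambda>z. (B o\<^sub>L R z) + z *\<^sub>C (A o\<^sub>L R z))"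
      by (intro laurent_on_add laurent_on_compose_left c cblin
          laurent_on_shift[where c = "\<lambda>j. A o\<^sub>L c j" and f = "\<lambda>z. A o\<^sub>L R z"])
    show "(B o\<^sub>L R z) + z *\<^sub>C (A o\<^sub>L R z) = id_blinfun" if "r < cmod z" "cmod z < s" for z
    proof -
      have "(B + z *\<^sub>C A) o\<^sub>L R z = id_blinfun"
        using inv[OF that] unfolding is_bounded_inverse_def by blast
      then show ?thesis
        by (simp add: blinfun_compose_simps scaleC_compose_left)
    qed
  qed
  from laurent_on_unique[OF this laurent_on_const[OF rs]]
  have "(B o\<^sub>L c j) + (A o\<^sub>L c (j - 1)) = (if j = 0 then id_blinfun else 0)" for j
    by meson
  with left show ?thesis
    unfolding inverse_coeffs_def by blast
qed

section \<open>Circle integrals of operator-valued functions\<close>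

text \<open>No continuity is assumed. The identity first bounds \<open>G\<close> near
  \<open>w\<close>, hence gives continuity at \<open>w\<close>, and inserting it once more gives the
  derivative.\<close>

lemma resolvent_identity_has_derivative:
  fixes G :: "complex \<Rightarrow> ('y::complex_banach \<Rightarrow>\<^sub>L 'x::complex_banach)"
  assumes G: "\<And>z w. G z - G w = (w - z) *\<^sub>C (G z o\<^sub>L A o\<^sub>L G w)"
  shows "(G has_derivative (\<lambda>h. h *\<^sub>C (- (G w o\<^sub>L A o\<^sub>L G w)))) (at w)"
proof -
  define K where "K = norm (A o\<^sub>L G w)"
  have le: "norm (G z - G w) \<le> cmod (z - w) * (norm (G z) * K)" for z
    unfolding G[of z w] norm_scaleC blinfun_compose_assoc K_def
    by (subst norm_minus_commute) (intro mult_left_mono norm_blinfun_compose norm_ge_zero)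
  \<comment> \<open>With the factor below \<open>1 / 2\<close>, the term \<open>norm (G z)\<close>
    on the right can be absorbed, so \<open>norm (G z)\<close> is at most
    \<open>2 * norm (G w)\<close>.\<close>
  have "\<forall>\<^sub>F z in at w. cmod (z - w) * K < 1 / 2"
    by (rule order_tendstoD(2)[of _ 0]) (auto intro!: tendsto_eq_intros)
  then have "\<forall>\<^sub>F z in at w. norm (G z - G w) \<le> cmod (z - w) * (2 * norm (G w) * K)"
  proof (rule eventually_mono)
    fix z assume z: "cmod (z - w) * K < 1 / 2"
    have "norm (G z) \<le> norm (G w) + norm (G z - G w)"
      using norm_triangle_sub by blast
    also have "\<dots> \<le> norm (G w) + (cmod (z - w) * K) * norm (G z)"
      using le[of z] by (simp add: mult_ac)
    also have "\<dots> \<le> norm (G w) + 1 / 2 * norm (G z)"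
      using z by (intro add_left_mono mult_right_mono) auto
    finally have "norm (G z) \<le> 2 * norm (G w)" by simp
    then have "cmod (z - w) * (norm (G z) * K) \<le> cmod (z - w) * (2 * norm (G w) * K)"
      by (intro mult_left_mono mult_right_mono) (auto simp: K_def)
    with le[of z] show "norm (G z - G w) \<le> cmod (z - w) * (2 * norm (G w) * K)"
      by linarith
  qed
  then have "((\<lambda>z. G z - G w) \<longlongrightarrow> 0) (at w)"
    by (rule Lim_null_comparison) (auto intro!: tendsto_eq_intros)
  then have lim: "((\<lambda>z. norm (G z - G w) * K) \<longlongrightarrow> 0) (at w)"
    by (intro tendsto_mult_left_zero tendsto_norm_zero)
  show ?thesis
    unfolding has_derivative_at_within
  proof (intro conjI)
    show "bounded_linear (\<lambda>h. h *\<^sub>C (- (G w o\<^sub>L A o\<^sub>L G w)))"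
      by (rule scaleC.bounded_linear_left)
    show "((\<lambda>z. (G z - G w - (z - w) *\<^sub>C (- (G w o\<^sub>L A o\<^sub>L G w))) /\<^sub>R norm (z - w)) \<longlongrightarrow> 0) (at w)"
    proof (rule Lim_null_comparison[OF always_eventually lim], rule allI)
      fix z
      have "G z - G w - (z - w) *\<^sub>C (- (G w o\<^sub>L A o\<^sub>L G w)) = (w - z) *\<^sub>C ((G z - G w) o\<^sub>L (A o\<^sub>L G w))"
      proof -
        have "(z - w) *\<^sub>C (- (G w o\<^sub>L A o\<^sub>L G w)) = (w - z) *\<^sub>C (G w o\<^sub>L (A o\<^sub>L G w))"
          by (simp add: blinfun_compose_assoc scaleC.diff_left scaleC.minus_right)
        then show ?thesis
          unfolding blinfun_compose_simps scaleC.diff_right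
          by (simp add: G[of z w] blinfun_compose_assoc)
      qed
      moreover have "norm ((G z - G w) o\<^sub>L (A o\<^sub>L G w)) \<le> norm (G z - G w) * K"
        unfolding K_def by (rule norm_blinfun_compose)
      ultimately show "norm ((G z - G w - (z - w) *\<^sub>C (- (G w o\<^sub>L A o\<^sub>L G w))) /\<^sub>R norm (z - w))
          \<le> norm (G z - G w) * K"
        by (cases "z = w") (simp_all add: norm_scaleC norm_minus_commute[of w z] K_def flip: mult.assoc)
    qed
  qed
qed

text \<open>The integral is differentiated in the radius. The resulting integrand is also an angular
  derivative of a periodic function, so the integral does not depend on the radius, and at radius
  \<open>0\<close> it vanishes.\<close>

lemma Cauchy_circle_at_0:
  fixes G :: "complex \<Rightarrow> 'a::{complex_normed_vector, banach}"
  assumes deriv: "\<And>w. (G has_derivative (\<lambda>h. h *\<^sub>C G' w)) (at w)"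
    and cont: "continuous_on UNIV G'"
  shows "integral {0..2 * pi} (\<lambda>t. (of_real s * cis t) *\<^sub>C G (of_real s * cis t)) = 0"
proof -
  define z :: "real \<Rightarrow> real \<Rightarrow> complex" where "z s t = of_real s * cis t" for s t
  define f where "f s t = z s t *\<^sub>C G (z s t)" for s t
  define f' where "f' s t = z s t *\<^sub>C cis t *\<^sub>C G' (z s t) + cis t *\<^sub>C G (z s t)" for s t
  have contG: "continuous_on UNIV G"
    using deriv by (meson UNIV_I continuous_at_imp_continuous_on has_derivative_continuous)
  have cont_z: "continuous_on X (\<lambda>x. z (g x) (h x))"
    if "continuous_on X g" "continuous_on X h" for X :: "'b::topological_space set" and g h
    unfolding z_def using that by (intro continuous_intros)
  have chain: "((\<lambda>x. G (\<gamma> x)) has_vector_derivative \<gamma>' *\<^sub>C G' (\<gamma> x)) (at x within X)"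
    if "(\<gamma> has_vector_derivative \<gamma>') (at x within X)" for \<gamma> \<gamma>' x X
    using has_derivative_compose[OF that[unfolded has_vector_derivative_def] deriv[of "\<gamma> x"]]
    unfolding has_vector_derivative_def by (simp add: scaleC.scaleR_left)
  have z_s: "((\<lambda>s. z s t) has_vector_derivative cis t) (at s within X)" for s t X
    unfolding z_def has_vector_derivative_def
    by (auto intro!: derivative_eq_intros simp: scaleR_conv_of_real)
  have z_t: "(z s has_vector_derivative \<i> * z s t) (at t within X)" for s t X
    unfolding z_def has_vector_derivative_def
    by (auto intro!: derivative_eq_intros simp: scaleR_conv_of_real fun_eq_iff)
  have cis_t: "((\<lambda>t. - \<i> * cis t) has_vector_derivative cis t) (at t within X)" for t X
    unfolding has_vector_derivative_def
    by (auto intro!: derivative_eq_intros simp: scaleR_conv_of_real fun_eq_iff mult_ac)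
  have f_s: "((\<lambda>s. f s t) has_vector_derivative f' s t) (at s within X)" for s t X
    unfolding f_def f'_def by (intro scaleC.has_vector_derivative chain z_s)
  have "((\<lambda>s. integral (cbox 0 (2 * pi)) (f s)) has_vector_derivative
      integral (cbox 0 (2 * pi)) (f' s)) (at s within UNIV)" for s
  proof (rule leibniz_rule_vector_derivative)
    show "f s integrable_on cbox 0 (2 * pi)" for s
      unfolding f_def
      by (intro integrable_continuous scaleC.continuous_on cont_z continuous_on_compose2[OF contG]
          continuous_intros) auto
    show "continuous_on (UNIV \<times> cbox 0 (2 * pi)) (\<lambda>(s, t). f' s t)"
      unfolding f'_def case_prod_beta
      by (intro scaleC.continuous_on continuous_on_add cont_z continuous_on_compose2[OF contG]
          continuous_on_compose2[OF cont] continuous_intros) auto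
  qed (use f_s in auto)
  moreover have "integral (cbox 0 (2 * pi)) (f' s) = 0" for s
  proof -
    \<comment> \<open>A periodic antiderivative of \<open>f' s\<close> in the angle: differentiating
      \<open>z s t\<close> produces the factor \<open>\<i>\<close> that cancels
      \<open>- \<i>\<close>.\<close>
    define F where "F t = (- \<i> * cis t) *\<^sub>C G (z s t)" for t
    have "(f' s has_integral (F (2 * pi) - F 0)) {0..2 * pi}"
    proof (rule fundamental_theorem_of_calculus)
      fix t
      have "(F has_vector_derivative
          ((- \<i> * cis t) *\<^sub>C (\<i> * z s t) *\<^sub>C G' (z s t) + cis t *\<^sub>C G (z s t))) (at t within {0..2 * pi})"
        unfolding F_def by (intro scaleC.has_vector_derivative chain z_t cis_t)
      then show "(F has_vector_derivative f' s t) (at t within {0..2 * pi})"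
        unfolding f'_def scaleC_scaleC by (simp add: mult_ac)
    qed simp
    moreover have "F (2 * pi) = F 0"
      unfolding F_def z_def by simp
    ultimately show ?thesis
      by (simp add: integral_unique)
  qed
  ultimately obtain C where C: "\<And>s. integral (cbox 0 (2 * pi)) (f s) = C"
    using has_vector_derivative_zero_constant[of UNIV "\<lambda>s. integral (cbox 0 (2 * pi)) (f s)"]
    by auto
  have "f 0 = (\<lambda>t. 0)"
    by (simp add: f_def z_def scaleC.zero_left fun_eq_iff)
  then have "C = 0"
    using C[of 0] by simp
  then show ?thesis
    using C[of s] by (simp add: f_def[abs_def] z_def)
qed

section \<open>Spectral projections of a pencil\<close>

lemma is_bounded_inverse_unique:
  assumes "is_bounded_inverse T S" "is_bounded_inverse T S'"
  shows "S = S'"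
proof -
  have "S = (S' o\<^sub>L T) o\<^sub>L S"
    using assms unfolding is_bounded_inverse_def by simp
  also have "\<dots> = S'"
    unfolding blinfun_compose_assoc using assms by (simp add: is_bounded_inverse_def)
  finally show ?thesis .
qed

lemma is_bounded_inverse_resolvent:
  assumes "Cpx z \<notin> pencil_spectrum A0 A1"
  shows "is_bounded_inverse (pencil A0 A1 z) (resolvent A0 A1 z)"
proof -
  obtain S where "is_bounded_inverse (pencil A0 A1 z) S"
    using assms unfolding pencil_spectrum_def has_bounded_inverse_def by blast
  then show ?thesis
    unfolding resolvent_def using is_bounded_inverse_unique by (metis theI)
qed

lemma pencil_shift: "pencil A0 A1 w = pencil A0 A1 z + (w - z) *\<^sub>C A1"
  by (simp add: pencil_def scaleC.diff_left)

lemma zero_le_of_le_inverse: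
  fixes a C :: real
  assumes "\<And>s. s > s0 \<Longrightarrow> a \<le> C / s"
  shows "a \<le> 0"
proof (rule tendsto_lowerbound)
  show "((\<lambda>s. C / s) \<longlongrightarrow> 0) at_top"
    by (intro real_tendsto_divide_at_top[OF tendsto_const] filterlim_ident)
  show "\<forall>\<^sub>F s in at_top. a \<le> C / s"
    using eventually_gt_at_top[of s0] assms by (rule eventually_mono)
qed simp

locale pencil_laurent =
  fixes A0 A1 :: "'x::complex_banach \<Rightarrow>\<^sub>L 'y::complex_banach"
    and L :: "riemann_sphere \<Rightarrow> int \<Rightarrow> ('y \<Rightarrow>\<^sub>L 'x)"
    and \<sigma> :: "riemann_sphere set"
  assumes cblin: "A0 \<in> cblinfuns" "A1 \<in> cblinfuns"
    and \<sigma>_def: "\<sigma> = pencil_spectrum A0 A1"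
    and finite_\<sigma>: "finite \<sigma>"
    and laurent: "\<And>\<zeta>. \<zeta> \<in> \<sigma> \<Longrightarrow> laurent_coeffs \<sigma> (resolvent A0 A1) \<zeta> (L \<zeta>)"
    and L_cblin: "\<And>\<zeta> j. \<zeta> \<in> \<sigma> \<Longrightarrow> L \<zeta> j \<in> cblinfuns"
begin

abbreviation "A \<equiv> pencil A0 A1"
abbreviation "R \<equiv> resolvent A0 A1"
abbreviation "P \<equiv> spectral_proj_dom A0 A1 L"
abbreviation "Q \<equiv> spectral_proj_cod A0 A1 L"

definition F :: "complex set" where "F = {\<zeta>. Cpx \<zeta> \<in> \<sigma>}"

lemma finite_F: "finite F"
proof -
  have "F = Cpx -` \<sigma>"
    unfolding F_def by auto
  then show ?thesis
    using finite_\<sigma> by (simp add: finite_vimageI inj_def)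
qed

lemma A_cblin: "A z \<in> cblinfuns"
  unfolding pencil_def using cblin by (intro cblinfuns_add cblinfuns_scaleC)

lemma R_inverse:
  assumes "z \<notin> F"
  shows "is_bounded_inverse (A z) (R z)"
  using assms by (intro is_bounded_inverse_resolvent) (simp add: F_def flip: \<sigma>_def)

section \<open>Residues at the finite spectral points\<close>

lemma finite_annulus:
  assumes "\<zeta> \<in> F"
  obtains r where "r > 0" "laurent_on 0 r (L (Cpx \<zeta>)) (\<lambda>z. R (\<zeta> + z))"
    "\<And>z. 0 < cmod z \<Longrightarrow> cmod z < r \<Longrightarrow> \<zeta> + z \<notin> F"
proof -
  have "Cpx \<zeta> \<in> \<sigma>" using assms unfolding F_def by blast
  from laurent[OF this] obtain r where r: "r > 0" "\<And>z. 0 < cmod (z - \<zeta>) \<Longrightarrow> cmod (z - \<zeta>) < r \<Longrightarrow>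
        ((\<lambda>j. ((z - \<zeta>) powi j) *\<^sub>C L (Cpx \<zeta>) j) has_sum R z) UNIV"
    by auto
  \<comment> \<open>The series alone does not make \<open>R\<close> an inverse; the radius
    \<open>e\<close> excludes the other finite spectral points.\<close>
  obtain e where e: "e > 0" "\<And>w. w \<in> F \<Longrightarrow> w \<noteq> \<zeta> \<Longrightarrow> e \<le> dist \<zeta> w"
    using finite_set_avoid[OF finite_F, of \<zeta>] by blast
  show thesis
  proof (rule that[of "min r e"])
    show "min r e > 0" using r e by simp
    have "((\<lambda>j. (z powi j) *\<^sub>C L (Cpx \<zeta>) j) has_sum R (\<zeta> + z)) UNIV" if "0 < cmod z \<and> cmod z < min r e" for z
      using r(2)[of "\<zeta> + z"] that by simp
    then show "laurent_on 0 (min r e) (L (Cpx \<zeta>)) (\<lambda>z. R (\<zeta> + z))"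
      unfolding laurent_on_def using r e by simp
    show "\<zeta> + z \<notin> F" if "0 < cmod z" "cmod z < min r e" for z
      using e(2)[of "\<zeta> + z"] that by (auto simp: dist_norm)
  qed
qed

lemma finite_inverse_coeffs:
  assumes "\<zeta> \<in> F"
  shows "inverse_coeffs (A \<zeta>) A1 (L (Cpx \<zeta>))"
proof -
  obtain r where r: "laurent_on 0 r (L (Cpx \<zeta>)) (\<lambda>z. R (\<zeta> + z))"
    "\<And>z. 0 < cmod z \<Longrightarrow> cmod z < r \<Longrightarrow> \<zeta> + z \<notin> F"
    using finite_annulus[OF assms] by blast
  show ?thesis
  proof (rule laurent_on_inverse_coeffs[OF r(1) cblin(2) A_cblin])
    show "is_bounded_inverse (A \<zeta> + z *\<^sub>C A1) (R (\<zeta> + z))" if "0 < cmod z" "cmod z < r" for z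
      using R_inverse[OF r(2)[OF that]] pencil_shift[of A0 A1 "\<zeta> + z" \<zeta>] by simp
  qed
qed

lemma finite_bound:
  assumes "\<zeta> \<in> F"
  obtains r where "r > 0" "\<And>\<rho>. 0 < \<rho> \<Longrightarrow> \<rho> < r \<Longrightarrow> laurent_bound (L (Cpx \<zeta>)) \<rho>"
  using finite_annulus[OF assms] laurent_on_bound by metis

lemma finite_cblin: "\<zeta> \<in> F \<Longrightarrow> L (Cpx \<zeta>) j \<in> cblinfuns"
  using L_cblin unfolding F_def by blast

abbreviation res :: "complex \<Rightarrow> ('y \<Rightarrow>\<^sub>L 'x)" where "res \<zeta> \<equiv> L (Cpx \<zeta>) (-1)"

lemma res_products:
  assumes "\<zeta> \<in> F" "\<eta> \<in> F"
  shows "res \<zeta> o\<^sub>L A1 o\<^sub>L res \<eta> = (if \<zeta> = \<eta> then res \<zeta> else 0)"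
proof (cases "\<zeta> = \<eta>")
  case True
  obtain r where r: "r > 0" "\<And>\<rho>. 0 < \<rho> \<Longrightarrow> \<rho> < r \<Longrightarrow> laurent_bound (L (Cpx \<zeta>)) \<rho>"
    using finite_bound[OF assms(1)] by blast
  have "res \<zeta> o\<^sub>L A1 o\<^sub>L res \<zeta> = res \<zeta>"
    using r assms(1)
    by (intro residue_idempotent[where B = "A \<zeta>" and \<rho>\<^sub>1 = "r / 2" and \<rho>\<^sub>2 = "r / 3"] finite_inverse_coeffs finite_cblin) auto
  then show ?thesis using True by simp
next
  case False
  obtain r where r: "r > 0" "\<And>\<rho>. 0 < \<rho> \<Longrightarrow> \<rho> < r \<Longrightarrow> laurent_bound (L (Cpx \<zeta>)) \<rho>"
    using finite_bound[OF assms(1)] by blast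
  obtain s where s: "s > 0" "\<And>\<rho>. 0 < \<rho> \<Longrightarrow> \<rho> < s \<Longrightarrow> laurent_bound (L (Cpx \<eta>)) \<rho>"
    using finite_bound[OF assms(2)] by blast
  \<comment> \<open>Staying below half the distance of the two points is what the contraction in
    \<open>residues_orthogonal\<close> requires.\<close>
  obtain \<rho> where \<rho>: "0 < \<rho>" "\<rho> < min (min r s) (cmod (\<eta> - \<zeta>) / 2)"
    using dense[of 0 "min (min r s) (cmod (\<eta> - \<zeta>) / 2)"] r s False by auto
  have "res \<zeta> o\<^sub>L A1 o\<^sub>L res \<eta> = 0"
    using r s \<rho> assms finite_inverse_coeffs[of \<eta>] pencil_shift[of A0 A1 \<eta> \<zeta>]
    by (intro residues_orthogonal[where B = "A \<zeta>" and \<delta> = "\<eta> - \<zeta>" and \<rho> = \<rho>]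
        finite_inverse_coeffs finite_cblin) auto
  then show ?thesis using False by simp
qed

section \<open>The total finite projections and the complementary part of the resolvent\<close>

definition P0 where "P0 = (\<Sum>\<zeta>\<in>F. res \<zeta>) o\<^sub>L A1"
definition Q0 where "Q0 = A1 o\<^sub>L (\<Sum>\<zeta>\<in>F. res \<zeta>)"

lemma res_Q0:
  assumes "\<zeta> \<in> F"
  shows "res \<zeta> o\<^sub>L Q0 = res \<zeta>"
proof -
  have "res \<zeta> o\<^sub>L Q0 = (\<Sum>\<eta>\<in>F. res \<zeta> o\<^sub>L A1 o\<^sub>L res \<eta>)"
    unfolding Q0_def by (simp add: blinfun_compose_sum_right blinfun_compose_assoc)
  also have "\<dots> = (\<Sum>\<eta>\<in>F. if \<zeta> = \<eta> then res \<zeta> else 0)"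
    using assms by (intro sum.cong res_products) auto
  finally show ?thesis
    using assms finite_F by simp
qed

lemma Q0_idem: "Q0 o\<^sub>L Q0 = Q0"
proof -
  have "(\<Sum>\<zeta>\<in>F. res \<zeta>) o\<^sub>L Q0 = (\<Sum>\<zeta>\<in>F. res \<zeta>)"
    unfolding blinfun_compose_sum_left by (intro sum.cong refl res_Q0)
  then show ?thesis
    by (subst Q0_def) (simp add: blinfun_compose_assoc, simp add: Q0_def)
qed

text \<open>Each residue intertwines the pencil at its own point. Passing to another
  \<open>z\<close> adds a multiple of \<open>A1\<close>, which contributes the same term
  \<open>A1 o\<^sub>L res \<zeta> o\<^sub>L A1\<close> on both sides.\<close>

lemma Q0_intertwine: "Q0 o\<^sub>L A z = A z o\<^sub>L P0"
proof -
  have "A1 o\<^sub>L res \<zeta> o\<^sub>L A z = A z o\<^sub>L (res \<zeta> o\<^sub>L A1)" if \<zeta>: "\<zeta> \<in> F" for \<zeta>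
  proof -
    have "A1 o\<^sub>L res \<zeta> o\<^sub>L A \<zeta> = A \<zeta> o\<^sub>L (res \<zeta> o\<^sub>L A1)"
      using inverse_coeffs_intertwine[OF finite_inverse_coeffs[OF \<zeta>]] .
    then show ?thesis
      unfolding pencil_shift[of A0 A1 z \<zeta>] using cblin finite_cblin[OF \<zeta>]
      by (simp add: blinfun_compose_simps scaleC_compose_left scaleC_compose_right blinfun_compose_assoc)
  qed
  then show ?thesis
    unfolding P0_def Q0_def by (simp add: blinfun_compose_sum_left blinfun_compose_sum_right)
qed

text \<open>The part of the resolvent complementary to all finite spectral points: it extends over
  them and inverts the pencil between the ranges of \<open>1 - Q0\<close> and \<open>1 - P0\<close>.\<close>

definition G :: "complex \<Rightarrow> ('y \<Rightarrow>\<^sub>L 'x)" where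
  "G z = (if z \<in> F then L (Cpx z) 0 else R z) o\<^sub>L (id_blinfun - Q0)"

text \<open>At a spectral point the relation of index \<open>0\<close> makes
  \<open>L (Cpx z) 0\<close> a left inverse up to the defect \<open>res z o\<^sub>L A1\<close>, and
  \<open>id_blinfun - P0\<close> annihilates that defect.\<close>

lemma G_left: "G z o\<^sub>L A z = id_blinfun - P0"
proof -
  define S where "S = (if z \<in> F then L (Cpx z) 0 else R z)"
  have "(id_blinfun - Q0) o\<^sub>L A z = A z o\<^sub>L (id_blinfun - P0)"
    by (simp add: blinfun_compose_simps Q0_intertwine)
  then have eq: "G z o\<^sub>L A z = S o\<^sub>L A z o\<^sub>L (id_blinfun - P0)"
    unfolding G_def S_def by (simp add: blinfun_compose_assoc)
  show ?thesis
  proof (cases "z \<in> F")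
    case True
    have "S o\<^sub>L A z = id_blinfun - (res z o\<^sub>L A1)"
      using finite_inverse_coeffs[OF True] True unfolding inverse_coeffs_def S_def
      by (auto simp: eq_diff_eq dest!: spec[of _ 0])
    moreover have "res z o\<^sub>L A1 o\<^sub>L P0 = res z o\<^sub>L A1"
      using res_Q0[OF True] unfolding P0_def Q0_def by (simp flip: blinfun_compose_assoc)
    ultimately show ?thesis
      unfolding eq by (simp add: blinfun_compose_simps)
  next
    case False
    then show ?thesis
      unfolding eq S_def using R_inverse[OF False] by (simp add: is_bounded_inverse_def)
  qed
qed

lemma G_right: "A z o\<^sub>L G z = id_blinfun - Q0"
proof (cases "z \<in> F")
  case True
  have "A z o\<^sub>L L (Cpx z) 0 = id_blinfun - (A1 o\<^sub>L res z)"
    using finite_inverse_coeffs[OF True] unfolding inverse_coeffs_def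
    by (auto simp: eq_diff_eq dest!: spec[of _ 0])
  then have "A z o\<^sub>L G z = (id_blinfun - (A1 o\<^sub>L res z)) o\<^sub>L (id_blinfun - Q0)"
    unfolding G_def using True by (simp flip: blinfun_compose_assoc)
  then show ?thesis
    using res_Q0[OF True] by (simp add: blinfun_compose_simps blinfun_compose_assoc)
next
  case False
  then show ?thesis
    unfolding G_def using R_inverse[OF False]
    by (simp add: is_bounded_inverse_def flip: blinfun_compose_assoc)
qed

lemma G_absorb_right: "G z o\<^sub>L (id_blinfun - Q0) = G z"
proof -
  have "(id_blinfun - Q0) o\<^sub>L (id_blinfun - Q0) = id_blinfun - Q0"
    using Q0_idem by (simp add: blinfun_compose_simps)
  then show ?thesis
    unfolding G_def by (simp add: blinfun_compose_assoc)
qed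

text \<open>Both this and \<open>G_absorb_right\<close> say that
  \<open>G z o\<^sub>L A z o\<^sub>L G z\<close> equals \<open>G z\<close>.\<close>

lemma G_absorb_left: "(id_blinfun - P0) o\<^sub>L G z = G z"
  using G_absorb_right[of z] unfolding G_left[of z, symmetric] G_right[of z, symmetric]
  by (simp add: blinfun_compose_assoc)

lemma G_cblin: "G z \<in> cblinfuns"
proof -
  have "(if z \<in> F then L (Cpx z) 0 else R z) \<in> cblinfuns"
    using R_inverse finite_cblin by (auto simp: is_bounded_inverse_def)
  moreover have "Q0 \<in> cblinfuns"
    unfolding Q0_def by (intro cblinfuns_compose cblin cblinfuns_sum finite_cblin)
  ultimately show ?thesis
    unfolding G_def by (intro cblinfuns_compose cblinfuns_diff cblinfuns_id)
qed

text \<open>The usual computation survives although \<open>G\<close> inverts the pencil only up to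
  the complementary projections, because \<open>G\<close> absorbs them on either side.\<close>

lemma G_resolvent_identity: "G z - G w = (w - z) *\<^sub>C (G z o\<^sub>L A1 o\<^sub>L G w)"
proof -
  have "G z o\<^sub>L A w o\<^sub>L G w = G z"
    using G_right[of w] G_absorb_right[of z] by (simp add: blinfun_compose_assoc)
  moreover have "G z o\<^sub>L A z o\<^sub>L G w = G w"
    using G_left[of z] G_absorb_left[of w] by simp
  ultimately have "G z - G w = G z o\<^sub>L (A w - A z) o\<^sub>L G w"
    by (simp add: blinfun_compose_simps)
  also have "A w - A z = (w - z) *\<^sub>C A1"
    using pencil_shift[of A0 A1 w z] by simp
  finally show ?thesis
    using G_cblin by (simp add: scaleC_compose_left scaleC_compose_right)
qed

lemma G_has_derivative: "(G has_derivative (\<lambda>h. h *\<^sub>C (- (G w o\<^sub>L A1 o\<^sub>L G w)))) (at w)"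
  by (intro resolvent_identity_has_derivative G_resolvent_identity)

lemma continuous_on_G: "continuous_on X G"
  using G_has_derivative by (meson continuous_at_imp_continuous_on has_derivative_continuous)

lemma G_circle_integral:
  "((\<lambda>t. (of_real s * cis t) *\<^sub>C G (of_real s * cis t)) has_integral 0) {0..2 * pi}"
proof -
  have "continuous_on {0..2 * pi} (\<lambda>t. G (of_real s * cis t))"
    by (rule continuous_on_compose2[OF continuous_on_G[of UNIV]]) (auto intro!: continuous_intros)
  then have "(\<lambda>t. (of_real s * cis t) *\<^sub>C G (of_real s * cis t)) integrable_on {0..2 * pi}"
    by (intro integrable_continuous_interval scaleC.continuous_on) (auto intro!: continuous_intros)
  moreover have "continuous_on UNIV (\<lambda>w. - (G w o\<^sub>L A1 o\<^sub>L G w))"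
    by (intro continuous_on_minus bounded_bilinear.continuous_on[OF bounded_bilinear_blinfun_compose]
        continuous_on_G continuous_on_const)
  ultimately show ?thesis
    using Cauchy_circle_at_0[OF G_has_derivative] by (simp add: has_integral_iff)
qed

text \<open>The coefficient of index \<open>-1\<close> is split by \<open>Q0\<close>. On the range
  of \<open>Q0\<close> it reproduces each finite residue by absorption; on the complement it is a
  circle integral of the everywhere differentiable \<open>G\<close>, which is
  \<open>0\<close>.\<close>

lemma sum_res_infinity:
  assumes "Infty \<in> \<sigma>"
  shows "inverse_coeffs A0 A1 (L Infty)" "L Infty (-1) = (\<Sum>\<zeta>\<in>F. res \<zeta>)"
proof -
  let ?c = "L Infty"
  obtain r where r0: "r > 0" "\<And>\<zeta>. \<zeta> \<in> F \<Longrightarrow> cmod \<zeta> < r"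
    "\<And>z. cmod z > r \<Longrightarrow> ((\<lambda>j. (z powi j) *\<^sub>C ?c j) has_sum R z) UNIV"
    using laurent[OF assms] unfolding F_def by auto
  have r: "laurent_on r (r + 3) ?c R"
    using r0 unfolding laurent_on_def by auto
  show inv: "inverse_coeffs A0 A1 ?c"
  proof (rule laurent_on_inverse_coeffs[OF r cblin(2,1)])
    show "is_bounded_inverse (A0 + z *\<^sub>C A1) (R z)" if "r < cmod z" for z
      using R_inverse[of z] r0(2)[of z] that unfolding pencil_def by force
  qed
  have "?c (-1) o\<^sub>L A1 o\<^sub>L res \<zeta> = res \<zeta>" if \<zeta>: "\<zeta> \<in> F" for \<zeta>
  proof -
    obtain e where e: "e > 0" "\<And>\<rho>. 0 < \<rho> \<Longrightarrow> \<rho> < e \<Longrightarrow> laurent_bound (L (Cpx \<zeta>)) \<rho>"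
      using finite_bound[OF \<zeta>] by blast
    \<comment> \<open>The radius \<open>r + 2\<close> lies inside the annulus from \<open>r\<close>
      to \<open>r + 3\<close> and leaves room for a disc of radius at most \<open>1\<close> around
      \<open>\<zeta>\<close>.\<close>
    have "min (e / 2) 1 + cmod \<zeta> < r + 2"
      using r0(2)[OF \<zeta>] by auto
    then show ?thesis
      using e r finite_inverse_coeffs[OF \<zeta>] inv L_cblin[OF assms] unfolding pencil_def
      by (intro outer_residue_absorbs[where B = A0 and \<delta> = \<zeta> and \<rho> = "r + 2" and \<epsilon> = "min (e / 2) 1"]
        laurent_on_bound[OF r]) auto
  qed
  then have "?c (-1) o\<^sub>L Q0 = (\<Sum>\<zeta>\<in>F. res \<zeta>)"
    unfolding Q0_def by (simp add: blinfun_compose_sum_right flip: blinfun_compose_assoc)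
  moreover have "?c (-1) o\<^sub>L (id_blinfun - Q0) = 0"
  proof -
    have "laurent_on r (r + 3) (\<lambda>j. ?c j o\<^sub>L (id_blinfun - Q0)) G"
    proof (rule laurent_on_cong[OF laurent_on_compose_right[OF r]])
      show "R z o\<^sub>L (id_blinfun - Q0) = G z" if "r < cmod z" for z
        using r0(2)[of z] that unfolding G_def by force
    qed
    from laurent_on_coeff_integral[OF this, of "r + 1" "-1"] G_circle_integral[of "r + 1"]
    show ?thesis
      by (simp add: has_integral_iff)
  qed
  ultimately show "?c (-1) = (\<Sum>\<zeta>\<in>F. res \<zeta>)"
    by (simp add: blinfun_compose_simps)
qed

text \<open>For invertible \<open>A1\<close>, \<open>z *\<^sub>C G z\<close> approaches
  \<open>T\<close> at rate \<open>1 / cmod z\<close>, while its mean over every circle around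
  \<open>0\<close> is \<open>0\<close>. Hence \<open>T = 0\<close>, and applying \<open>A1\<close>
  gives \<open>Q0 = id_blinfun\<close>; conjugation by \<open>A1\<close> carries this over to
  \<open>P0\<close>.\<close>

lemma Q0_eq_id:
  assumes "Infty \<notin> \<sigma>"
  shows "Q0 = id_blinfun" "P0 = id_blinfun"
proof -
  obtain S where "S \<in> cblinfuns" and S: "S o\<^sub>L A1 = id_blinfun" "A1 o\<^sub>L S = id_blinfun"
    using assms unfolding \<sigma>_def pencil_spectrum_def has_bounded_inverse_def is_bounded_inverse_def
    by blast
  define T where "T = S o\<^sub>L (id_blinfun - Q0)"
  define k where "k = norm (S o\<^sub>L A0)"
  have zG: "z *\<^sub>C G z - T = - (S o\<^sub>L A0 o\<^sub>L G z)" for z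
  proof -
    have "T = S o\<^sub>L (A z o\<^sub>L G z)"
      unfolding T_def G_right ..
    also have "\<dots> = (S o\<^sub>L A0 o\<^sub>L G z) + z *\<^sub>C G z"
      unfolding pencil_def using S \<open>S \<in> cblinfuns\<close>
      by (simp add: blinfun_compose_simps scaleC_compose_left scaleC_compose_right flip: blinfun_compose_assoc)
    finally show ?thesis by simp
  qed
  \<comment> \<open>For \<open>cmod z > 2 * k\<close> the error \<open>k * norm (G z)\<close> is at
    most half of \<open>cmod z * norm (G z)\<close> and is absorbed, so \<open>norm (G z)\<close> is
    at most \<open>2 * norm T / cmod z\<close>.\<close>
  have bound: "norm (z *\<^sub>C G z - T) \<le> k * (2 * norm T) / cmod z" if z: "cmod z > 2 * k" for z
  proof -
    have k: "k \<ge> 0" unfolding k_def by simp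
    have le: "norm (z *\<^sub>C G z - T) \<le> k * norm (G z)"
      unfolding zG k_def norm_minus_cancel by (rule norm_blinfun_compose)
    have "cmod z * norm (G z) \<le> norm T + norm (z *\<^sub>C G z - T)"
      unfolding norm_scaleC[symmetric] using norm_triangle_sub by blast
    also have "\<dots> \<le> norm T + cmod z / 2 * norm (G z)"
      using le z mult_right_mono[of k "cmod z / 2" "norm (G z)"] by simp
    finally have "cmod z * norm (G z) \<le> 2 * norm T"
      by simp
    moreover have "cmod z > 0"
      using z k by linarith
    ultimately have "norm (G z) \<le> 2 * norm T / cmod z"
      by (simp add: pos_le_divide_eq mult.commute)
    then have "k * norm (G z) \<le> k * (2 * norm T / cmod z)"
      using k by (rule mult_left_mono)
    with le show ?thesis by simp
  qed
  have "norm T \<le> 0"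
  proof (rule zero_le_of_le_inverse[of "2 * k"])
    fix s :: real assume s: "s > 2 * k"
    define z where "z t = of_real s * cis t" for t
    have "s > 0" using s norm_ge_zero[of "S o\<^sub>L A0"] unfolding k_def by linarith
    then have z: "cmod (z t) = s" for t by (simp add: z_def norm_mult)
    have "((\<lambda>t. z t *\<^sub>C G (z t)) has_integral 0) {0..2 * pi}"
      unfolding z_def by (rule G_circle_integral)
    from has_integral_diff[OF this has_integral_const_real[of T]]
    have "((\<lambda>t. z t *\<^sub>C G (z t) - T) has_integral - ((2 * pi) *\<^sub>R T)) {0..2 * pi}"
      by simp
    then have "norm (- ((2 * pi) *\<^sub>R T)) \<le> (k * (2 * norm T) / s) * measure lborel (cbox 0 (2 * pi))"
      using bound[of "z _"] z s \<open>s > 0\<close>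
      by (intro has_integral_bound[of _ "\<lambda>t. z t *\<^sub>C G (z t) - T"]) (auto simp: k_def)
    then have "(2 * pi) * norm T \<le> (2 * pi) * (k * (2 * norm T) / s)"
      by (simp add: mult_ac)
    then show "norm T \<le> k * (2 * norm T) / s"
      by (rule mult_left_le_imp_le) simp
  qed
  then have "T = 0" by simp
  then have "A1 o\<^sub>L (S o\<^sub>L (id_blinfun - Q0)) = 0"
    unfolding T_def by simp
  then have "A1 o\<^sub>L S o\<^sub>L (id_blinfun - Q0) = 0"
    by (simp only: blinfun_compose_assoc)
  then show Q0: "Q0 = id_blinfun"
    using S by simp
  have "P0 = S o\<^sub>L (A1 o\<^sub>L (\<Sum>\<zeta>\<in>F. res \<zeta>)) o\<^sub>L A1"
    unfolding P0_def using S by (simp flip: blinfun_compose_assoc)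
  also have "\<dots> = id_blinfun"
    using Q0 S unfolding Q0_def by simp
  finally show "P0 = id_blinfun" .
qed


section \<open>Assembling the resolutions of the identity\<close>

lemma \<sigma>_split: "\<sigma> = (if Infty \<in> \<sigma> then {Infty} else {}) \<union> Cpx ` F"
proof -
  have "p \<in> \<sigma> \<longleftrightarrow> p \<in> (if Infty \<in> \<sigma> then {Infty} else {}) \<union> Cpx ` F" for p
    by (cases p) (auto simp: F_def)
  then show ?thesis by blast
qed

lemma sum_\<sigma>: "(\<Sum>p\<in>\<sigma>. T p) = (if Infty \<in> \<sigma> then T Infty else 0) + (\<Sum>\<zeta>\<in>F. T (Cpx \<zeta>))"
proof -
  have "(\<Sum>p\<in>Cpx ` F. T p) = (\<Sum>\<zeta>\<in>F. T (Cpx \<zeta>))"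
    by (subst sum.reindex) (auto simp: inj_on_def)
  moreover have "Infty \<notin> Cpx ` F" by auto
  ultimately show ?thesis
    using finite_F by (subst \<sigma>_split) (simp del: image_iff)
qed

text \<open>The relations of index \<open>0\<close> at infinity trade \<open>A0\<close> with the
  coefficient \<open>0\<close> for \<open>A1\<close> with the coefficient \<open>-1\<close>, which
  is the sum of the finite residues.\<close>

lemma proj_infinity:
  assumes "Infty \<in> \<sigma>"
  shows "P Infty = id_blinfun - P0" "Q Infty = id_blinfun - Q0"
  using inverse_coeffs_left[OF sum_res_infinity(1)[OF assms], of 0]
    inverse_coeffs_right[OF sum_res_infinity(1)[OF assms], of 0]
  unfolding P0_def Q0_def sum_res_infinity(2)[OF assms, symmetric] by simp_all

lemma proj_products:
  assumes "\<zeta> \<in> F" "\<eta> \<in> F"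
  shows "P (Cpx \<zeta>) o\<^sub>L P (Cpx \<eta>) = (if \<zeta> = \<eta> then P (Cpx \<zeta>) else 0)"
    and "Q (Cpx \<zeta>) o\<^sub>L Q (Cpx \<eta>) = (if \<zeta> = \<eta> then Q (Cpx \<zeta>) else 0)"
  using arg_cong[OF res_products[OF assms], of "\<lambda>S. S o\<^sub>L A1"]
    arg_cong[OF res_products[OF assms], of "\<lambda>S. A1 o\<^sub>L S"]
  by (auto simp: blinfun_compose_assoc)

text \<open>Serves \<open>P\<close> and \<open>Q\<close> alike. The sum \<open>S\<close> of the
  orthogonal idempotents at finite points is idempotent and absorbs each of them, so its complement
  at infinity is an idempotent orthogonal to all of them.\<close>

lemma resolution_of_identity_complement:
  fixes T :: "riemann_sphere \<Rightarrow> ('a::complex_banach \<Rightarrow>\<^sub>L 'a)"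
  assumes "\<sigma> \<noteq> {}"
    and clinear: "\<And>p. p \<in> \<sigma> \<Longrightarrow> T p \<in> cblinfuns"
    and products: "\<And>\<zeta> \<eta>. \<zeta> \<in> F \<Longrightarrow> \<eta> \<in> F \<Longrightarrow> T (Cpx \<zeta>) o\<^sub>L T (Cpx \<eta>) = (if \<zeta> = \<eta> then T (Cpx \<zeta>) else 0)"
    and S: "S = (\<Sum>\<zeta>\<in>F. T (Cpx \<zeta>))"
    and infinity: "Infty \<in> \<sigma> \<Longrightarrow> T Infty = id_blinfun - S"
    and no_infinity: "Infty \<notin> \<sigma> \<Longrightarrow> S = id_blinfun"
  shows "resolution_of_identity \<sigma> T"
proof
  have left: "T (Cpx \<zeta>) o\<^sub>L S = T (Cpx \<zeta>)" and right: "S o\<^sub>L T (Cpx \<zeta>) = T (Cpx \<zeta>)"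
    if "\<zeta> \<in> F" for \<zeta>
    unfolding S blinfun_compose_sum_left blinfun_compose_sum_right
    using that finite_F by (simp_all add: products)
  have "S o\<^sub>L S = (\<Sum>\<zeta>\<in>F. T (Cpx \<zeta>) o\<^sub>L S)"
    by (subst (1) S) (rule blinfun_compose_sum_left)
  then have idem0: "S o\<^sub>L S = S"
    using left S by simp
  show "T p o\<^sub>L T p = T p" if "p \<in> \<sigma>" for p
    using that products idem0 infinity by (cases p) (auto simp: F_def blinfun_compose_simps)
  show "T p o\<^sub>L T q = 0" if "p \<in> \<sigma>" "q \<in> \<sigma>" "p \<noteq> q" for p q
    using that products left right infinity
    by (cases p; cases q) (auto simp: F_def blinfun_compose_simps)
  show "(\<Sum>p\<in>\<sigma>. T p) = id_blinfun"
    unfolding sum_\<sigma> using infinity no_infinity S by simp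
qed (use assms(1) clinear finite_\<sigma> in auto)

lemma resolution_P: "\<sigma> \<noteq> {} \<Longrightarrow> resolution_of_identity \<sigma> P"
proof (rule resolution_of_identity_complement[where S = P0])
  show "P p \<in> cblinfuns" if "p \<in> \<sigma>" for p
    using that cblin L_cblin by (cases p) (auto intro: cblinfuns_compose)
qed (use proj_products proj_infinity Q0_eq_id in \<open>auto simp: P0_def blinfun_compose_sum_left\<close>)

lemma resolution_Q: "\<sigma> \<noteq> {} \<Longrightarrow> resolution_of_identity \<sigma> Q"
proof (rule resolution_of_identity_complement[where S = Q0])
  show "Q p \<in> cblinfuns" if "p \<in> \<sigma>" for p
    using that cblin L_cblin by (cases p) (auto intro: cblinfuns_compose)
qed (use proj_products proj_infinity Q0_eq_id in \<open>auto simp: Q0_def blinfun_compose_sum_right\<close>)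

end

theorem proposition1:
  fixes A0 A1 :: "'x::complex_banach \<Rightarrow>\<^sub>L 'y::complex_banach"
    and L :: "riemann_sphere \<Rightarrow> int \<Rightarrow> ('y \<Rightarrow>\<^sub>L 'x)"
    and \<sigma> :: "riemann_sphere set"
    and P :: "riemann_sphere \<Rightarrow> ('x \<Rightarrow>\<^sub>L 'x)"
    and Q :: "riemann_sphere \<Rightarrow> ('y \<Rightarrow>\<^sub>L 'y)"
  assumes "A0 \<in> cblinfuns" and "A1 \<in> cblinfuns" and "A0 \<noteq> 0" and "A1 \<noteq> 0"
    and "\<sigma> = pencil_spectrum A0 A1" and "\<sigma> \<noteq> {}" and "finite \<sigma>"
    and "\<And>p. p \<notin> \<sigma> \<Longrightarrow> analytic_at_point (resolvent A0 A1) p"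
    and "\<And>\<zeta>. \<zeta> \<in> \<sigma> \<Longrightarrow> laurent_coeffs \<sigma> (resolvent A0 A1) \<zeta> (L \<zeta>)"
    and "\<And>\<zeta> j. \<zeta> \<in> \<sigma> \<Longrightarrow> L \<zeta> j \<in> cblinfuns"
    and "P = spectral_proj_dom A0 A1 L"
    and "Q = spectral_proj_cod A0 A1 L"
  shows "(\<forall>\<zeta>\<in>\<sigma>. csubspace (range (P \<zeta>)) \<and> closed (range (P \<zeta>)) \<and> complete (range (P \<zeta>))) \<and>
         (\<forall>\<zeta>\<in>\<sigma>. csubspace (range (Q \<zeta>)) \<and> closed (range (Q \<zeta>)) \<and> complete (range (Q \<zeta>))) \<and>
         topological_direct_sum \<sigma> (\<lambda>\<zeta>. range (P \<zeta>)) \<and>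
         topological_direct_sum \<sigma> (\<lambda>\<zeta>. range (Q \<zeta>)) \<and>
         banach_product_isomorphism \<sigma> (\<lambda>\<zeta>. range (P \<zeta>))
           (\<lambda>x. \<lambda>\<zeta>\<in>\<sigma>. P \<zeta> x) (\<lambda>f. \<Sum>\<zeta>\<in>\<sigma>. f \<zeta>) \<and>
         banach_product_isomorphism \<sigma> (\<lambda>\<zeta>. range (Q \<zeta>))
           (\<lambda>y. \<lambda>\<zeta>\<in>\<sigma>. Q \<zeta> y) (\<lambda>f. \<Sum>\<zeta>\<in>\<sigma>. f \<zeta>)"
proof -
  interpret pencil_laurent A0 A1 L \<sigma>
    using assms by unfold_locales auto
  interpret P: resolution_of_identity \<sigma> P
    unfolding assms(11) using resolution_P assms(6) by blast
  interpret Q: resolution_of_identity \<sigma> Q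
    unfolding assms(12) using resolution_Q assms(6) by blast
  show ?thesis
    using P.subspaces P.direct_sum P.product_isomorphism
      Q.subspaces Q.direct_sum Q.product_isomorphism by blast
qed

end
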